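(* Let $W$ be a triangle-free graphon. Then either $a(W)=0$ or $W$ is isomorphic to $W_{G,\mu}$ for some finite vertex-weighted triangle-free graph $(G,\mu)$.
   Context: A graphon is a symmetric measurable function $W:[0,1]\times[0,1]\to[0,1]$. It is triangle-free if $\int\int\int W(x,y)W(y,z)W(x,z)\,dx\,dy\,dz=0$. Given a graphon $W$, put $P_3^N(x,y)=\int_0^1 W(x,z)W(y,z)\,dz$ (defined a.e. and measurable). Then $a(W)$ is the maximum value $a$ such that $$\lambda\Big(\big\{(x,y)\in[0,1]^2 : W(x,y)<1 \Longrightarrow P_3^N(x,y)\ge a\big\}\Big)=1,$$ where $\lambda$ is Lebesgue measure. A vertex-weighted graph $(G,\mu)$ is a finite simple graph $G$ with a probability measure $\mu$ on $V(G)$. Its step-function graphon $W_{G,\mu}$ is obtained by partitioning $[0,1]$ into measurable sets (intervals) $I_v$, $v\in V(G)$, with $\lambda(I_v)=\mu(v)$, and setting $W_{G,\mu}(x,y)=1$ if $x\in I_u$, $y\in I_v$ with $(u,v)\in E(G)$, and $W_{G,\mu}(x,y)=0$ otherwise. Two graphons are isomorphic if they have the same sampling statistics: for every $n$, the random graph on $n$ vertices obtained by choosing $x_1,\dots,x_n\in[0,1]$ independently and uniformly and joining $i,j$ independently with probability $W(x_i,x_j)$ has the same distribution for both graphons (equivalently, all homomorphism densities of finite simple graphs coincide). The "either ... or" is not exclusive. *)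

theory Defs
  imports "HOL-Probability.Probability" "HOL-Probability.Product_PMF" "Graph_Theory.Pair_Digraph"
begin

(* Graphons are total functions on the plane of which only the restriction to the unit square
   matters.  Measurability is Lebesgue measurability. *)
definition graphon :: "(real \<Rightarrow> real \<Rightarrow> real) \<Rightarrow> bool" where
  "graphon W \<longleftrightarrow>
     case_prod W \<in> borel_measurable (lebesgue_on ({0..1} \<times> {0..1})) \<and>
     (\<forall>x\<in>{0..1}. \<forall>y\<in>{0..1}. W x y \<in> {0..1}) \<and>
     (\<forall>x\<in>{0..1}. \<forall>y\<in>{0..1}. W x y = W y x)"

definition triangle_free_graphon :: "(real \<Rightarrow> real \<Rightarrow> real) \<Rightarrow> bool" where
  "triangle_free_graphon W \<longleftrightarrow>
     (LINT (x, y, z)|lebesgue_on ({0..1} \<times> {0..1} \<times> {0..1}). W x y * W y z * W x z) = 0"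

(* Sections of a Lebesgue measurable function are measurable only almost everywhere; on the
   exceptional null set the integral may take the default value 0. *)
definition P3N :: "(real \<Rightarrow> real \<Rightarrow> real) \<Rightarrow> real \<Rightarrow> real \<Rightarrow> real" where
  "P3N W x y = (LINT z|lebesgue_on {0..1}. W x z * W y z)"

(* The maximum exists unless W = 1 almost everywhere on the unit square (every real number is then
   admissible, and the value is unspecified); in particular it exists for triangle-free graphons. *)
definition a_val :: "(real \<Rightarrow> real \<Rightarrow> real) \<Rightarrow> real" where
  "a_val W = (GREATEST a.
     measure lebesgue {(x, y) \<in> {0..1} \<times> {0..1}. W x y < 1 \<longrightarrow> P3N W x y \<ge> a} = 1)"

definition vertex_pairs :: "nat \<Rightarrow> (nat \<times> nat) set" where
  "vertex_pairs n = {(i, j). i < j \<and> j < n}"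

(* A graph on the vertices 0, ..., n - 1 is encoded by the indicator of its edges {i, j} with i < j,
   which is False outside vertex_pairs n. *)
definition sampled_graph_given ::
    "(real \<Rightarrow> real \<Rightarrow> real) \<Rightarrow> nat \<Rightarrow> (nat \<Rightarrow> real) \<Rightarrow> (nat \<times> nat \<Rightarrow> bool) pmf" where
  "sampled_graph_given W n x =
     Pi_pmf (vertex_pairs n) False (\<lambda>(i, j). bernoulli_pmf (W (x i) (x j)))"

(* Completing the product measure makes W (x i) (x j) measurable in x for every Lebesgue
   measurable W. *)
definition sample_points :: "nat \<Rightarrow> (nat \<Rightarrow> real) measure" where
  "sample_points n = completion (PiM {..<n} (\<lambda>_. lebesgue_on {0..1}))"

definition sampled_graph_prob ::
    "(real \<Rightarrow> real \<Rightarrow> real) \<Rightarrow> nat \<Rightarrow> (nat \<times> nat \<Rightarrow> bool) \<Rightarrow> real" where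
  "sampled_graph_prob W n F = (LINT x|sample_points n. pmf (sampled_graph_given W n x) F)"

(* There are only finitely many graphs on n labelled vertices, so two distributions on them agree
   iff they give each single graph the same probability. *)
definition graphon_isomorphic ::
    "(real \<Rightarrow> real \<Rightarrow> real) \<Rightarrow> (real \<Rightarrow> real \<Rightarrow> real) \<Rightarrow> bool" where
  "graphon_isomorphic W U \<longleftrightarrow> (\<forall>n F. sampled_graph_prob W n F = sampled_graph_prob U n F)"

(* A finite simple graph is a pair_graph: a finite loopfree digraph whose arc set is symmetric.
   Vertices of weight 0 are allowed. *)
definition vertex_weighted_graph :: "'v pair_pre_digraph \<Rightarrow> 'v pmf \<Rightarrow> bool" where
  "vertex_weighted_graph G \<mu> \<longleftrightarrow> pair_graph G \<and> set_pmf \<mu> \<subseteq> pverts G"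

definition triangle_free_graph :: "'v pair_pre_digraph \<Rightarrow> bool" where
  "triangle_free_graph G \<longleftrightarrow>
     \<not> (\<exists>u v w. (u, v) \<in> parcs G \<and> (v, w) \<in> parcs G \<and> (u, w) \<in> parcs G)"

(* A part I v is empty or a single point if the weight of v is 0. *)
definition weight_partition ::
    "'v pair_pre_digraph \<Rightarrow> 'v pmf \<Rightarrow> ('v \<Rightarrow> real set) \<Rightarrow> bool" where
  "weight_partition G \<mu> I \<longleftrightarrow>
     (\<forall>v\<in>pverts G. is_interval (I v) \<and> measure lebesgue (I v) = pmf \<mu> v) \<and>
     disjoint_family_on I (pverts G) \<and> (\<Union>v\<in>pverts G. I v) = {0..1}"

definition step_graphon :: "'v pair_pre_digraph \<Rightarrow> ('v \<Rightarrow> real set) \<Rightarrow> real \<Rightarrow> real \<Rightarrow> real" where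
  "step_graphon G I x y = (if \<exists>(u, v)\<in>parcs G. x \<in> I u \<and> y \<in> I v then 1 else 0)"

end

theory Submission
  imports Defs
begin

text \<open>
  Suppose that \<open>a(W) \<noteq> 0\<close>, so that for some \<open>a > 0\<close> almost every pair \<open>x\<close>, \<open>y\<close> with \<open>W x y < 1\<close> has
  codegree \<open>P3N W x y\<close> at least \<open>a\<close>. Since there are no triangles, almost every pair with \<open>W x y > 0\<close> has
  codegree 0. Hence \<open>W\<close> takes only the values 0 and 1 almost everywhere: it is the indicator of a
  symmetric set \<open>E\<close> in which adjacent pairs have codegree 0 and nonadjacent pairs have codegree at
  least \<open>a\<close>.

  Two points of such a graph either have the same neighbourhood up to a null set, that is, they are
  twins, or their neighbourhoods differ by measure at least \<open>a\<close>: a point \<open>z\<close> that is adjacent to \<open>x\<close> but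
  not to \<open>y\<close> has codegree 0 with \<open>x\<close> and at least \<open>a\<close> with \<open>y\<close> (\<open>twins_if_neighbourhoods_close\<close>).
  On the other hand neighbourhoods cannot be far apart too often. As \<open>E\<close> is measurable, it is close to
  a set with finitely many sections (\<open>approx_by_finitely_many_sections\<close>), so that finitely many twin
  classes cover all but measure less than \<open>a\<close>. The neighbourhood of any further point is determined,
  up to measure less than \<open>a\<close>, by the finitely many classes it is joined to, and by the gap it is
  then determined up to a null set. So there are only finitely many twin classes in total
  (\<open>finitely_many_twin_classes\<close>).

  Finitely many twin classes mean that \<open>E\<close> is a union of products of classes up to a null set
  (\<open>step_structure\<close>). The graph on the classes is triangle-free, and the sampling statistics of \<open>W\<close>
  depend only on this graph and the measures of the classes (\<open>sampled_graph_prob_step\<close>). Replacing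
  the classes by intervals of the same lengths gives the step graphon.
\<close>

section \<open>Approximation by sets with finitely many sections\<close>

lemma finite_sections_complement:
  assumes "finite ((\<lambda>x. Pair x -` U) ` A)"
  shows "finite ((\<lambda>x. Pair x -` (A \<times> B - U)) ` A)"
proof -
  have "(\<lambda>x. Pair x -` (A \<times> B - U)) ` A \<subseteq> (\<lambda>S. B - S) ` (\<lambda>x. Pair x -` U) ` A"
    by auto
  then show ?thesis
    using assms finite_surj by blast
qed

lemma finite_sections_Union:
  assumes "finite I" "\<And>i. i \<in> I \<Longrightarrow> finite ((\<lambda>x. Pair x -` U i) ` A)"
  shows "finite ((\<lambda>x. Pair x -` (\<Union>i\<in>I. U i)) ` A)"
  using assms
proof (induction I)
  case empty
  show ?case
    by (rule finite_subset[of _ "{{}}"]) auto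
next
  case (insert i I)
  have "(\<lambda>x. Pair x -` (\<Union>j\<in>insert i I. U j)) ` A
      \<subseteq> (\<lambda>(S, T). S \<union> T) ` ((\<lambda>x. Pair x -` U i) ` A \<times> (\<lambda>x. Pair x -` (\<Union>j\<in>I. U j)) ` A)"
    by (auto simp: image_iff vimage_Un)
  then show ?case
    using insert by (meson finite_SigmaI finite_surj insertCI)
qed

text \<open>Rectangles have at most two different sections, and having finitely many sections is preserved by
  complements and finite unions. So the sets that can be approximated contain the rectangles and form
  a Dynkin system: a countable disjoint union is within \<open>e / 2\<close> of a finite partial union by
  continuity of the measure, and the error of approximating its terms separately is kept below
  \<open>e / 2\<close>. In the proof that there are finitely many twin classes this plays the role of compactness
  of the integral operator of the graphon.
\<close>

lemma approx_by_finitely_many_sections: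
  assumes L: "finite_measure L" "sets L = sets (M \<Otimes>\<^sub>M N)"
    and E: "E \<in> sets (M \<Otimes>\<^sub>M N)" and e: "e > 0"
  shows "\<exists>U \<in> sets L. finite ((\<lambda>x. Pair x -` U) ` space M) \<and> measure L (sym_diff E U) < e"
proof -
  interpret finite_measure L by fact
  have sp: "space L = space M \<times> space N"
    using sets_eq_imp_space_eq[OF L(2)] by (simp add: space_pair_measure)
  let ?G = "{a \<times> b |a b. a \<in> sets M \<and> b \<in> sets N}"
  have "?G \<subseteq> Pow (space M \<times> space N)"
    using pair_measure_closed by blast
  moreover have "E \<in> sigma_sets (space M \<times> space N) ?G"
    using E by (simp add: sets_pair_measure)
  ultimately have "E \<in> sets L \<and> (\<forall>e>0. \<exists>U \<in> sets L. finite ((\<lambda>x. Pair x -` U) ` space M) \<and>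
      measure L (sym_diff E U) < e)"
  proof (induction rule: sigma_sets_induct_disjoint[OF Int_stable_pair_measure_generator, consumes 2,
      case_names basic empty compl union])
    case (basic A)
    then obtain a b where ab: "A = a \<times> b" "a \<in> sets M" "b \<in> sets N" by blast
    have "A \<in> sets L" using ab L(2) by auto
    moreover have "finite ((\<lambda>x. Pair x -` A) ` space M)"
      by (rule finite_subset[of _ "{b, {}}"]) (use ab in auto)
    ultimately show ?case
      by (auto intro!: bexI[of _ A])
  next
    case empty
    have "finite ((\<lambda>x. Pair x -` {}) ` space M)"
      by (rule finite_subset[of _ "{{}}"]) auto
    then show ?case
      by (auto intro!: bexI[of _ "{}"])
  next
    case (compl A)
    note A = compl.IH
    have "\<exists>U \<in> sets L. finite ((\<lambda>x. Pair x -` U) ` space M) \<and>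
      measure L (sym_diff (space M \<times> space N - A) U) < e" if e: "e > 0" for e
    proof -
      obtain U where U: "U \<in> sets L" "finite ((\<lambda>x. Pair x -` U) ` space M)"
        "measure L (sym_diff A U) < e" using A e by blast
      have "sym_diff (space M \<times> space N - A) (space M \<times> space N - U) = sym_diff A U"
        using A U(1) sets.sets_into_space[of A L] sets.sets_into_space[of U L] sp by auto
      then show ?thesis
        using U finite_sections_complement[OF U(2), of "space N"] sets.compl_sets[OF U(1)] sp
        by (intro bexI[of _ "space M \<times> space N - U"]) auto
    qed
    then show ?case
      using A sets.compl_sets[of A L] sp by simp
  next
    case (union A)
    note A = union.hyps(1) union.IH
    have "\<exists>U \<in> sets L. finite ((\<lambda>x. Pair x -` U) ` space M) \<and>
      measure L (sym_diff (\<Union>i. A i) U) < e" if e: "e > 0" for e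
    proof -
      have lim: "(\<lambda>n. measure L (\<Union>i<n. A i)) \<longlonglongrightarrow> measure L (\<Union>n. \<Union>i<n. A i)"
        using A(2) by (intro finite_Lim_measure_incseq) (auto simp: incseq_def, fastforce)
      have un: "(\<Union>n. \<Union>i<n. A i) = (\<Union>i. A i)" by auto
      obtain n where n: "\<bar>measure L (\<Union>i<n. A i) - measure L (\<Union>i. A i)\<bar> < e / 2"
        using LIMSEQ_D[OF lim, of "e/2"] e unfolding un by auto
      have "\<forall>i. \<exists>U \<in> sets L. finite ((\<lambda>x. Pair x -` U) ` space M) \<and>
         measure L (sym_diff (A i) U) < e / (2 * (real n + 1))"
        using A(2) e by simp
      then obtain U where U: "\<And>i. U i \<in> sets L"
        "\<And>i. finite ((\<lambda>x. Pair x -` U i) ` space M)"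
        "\<And>i. measure L (sym_diff (A i) (U i)) < e / (2 * (real n + 1))"
        by metis
      have m: "\<And>i. A i \<in> sets L" using A by blast
      have "measure L (sym_diff (\<Union>i. A i) (\<Union>i<n. U i))
        \<le> measure L (((\<Union>i. A i) - (\<Union>i<n. A i)) \<union> (\<Union>i<n. sym_diff (A i) (U i)))"
        using m U(1) by (intro finite_measure_mono) auto
      also have "\<dots> \<le> measure L ((\<Union>i. A i) - (\<Union>i<n. A i)) + measure L (\<Union>i<n. sym_diff (A i) (U i))"
        using m U(1) by (intro measure_Un_le) auto
      also have "measure L (\<Union>i<n. sym_diff (A i) (U i)) \<le> (\<Sum>i<n. measure L (sym_diff (A i) (U i)))"
        using m U(1) by (intro finite_measure_subadditive_finite) auto
      also have "\<dots> \<le> (\<Sum>i<n. e / (2 * (real n + 1)))"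
        using U(3) by (intro sum_mono) (simp add: less_imp_le)
      also have "\<dots> \<le> e / 2"
        using e by (simp add: field_simps)
      also have "measure L ((\<Union>i. A i) - (\<Union>i<n. A i)) < e / 2"
      proof -
        have "measure L ((\<Union>i. A i) - (\<Union>i<n. A i)) = measure L (\<Union>i. A i) - measure L (\<Union>i<n. A i)"
          using m by (intro finite_measure_Diff) auto
        then show ?thesis using n by linarith
      qed
      finally have "measure L (sym_diff (\<Union>i. A i) (\<Union>i<n. U i)) < e" by simp
      then show ?thesis
        using U(1) finite_sections_Union[of "{..<n}" U "space M"] U(2)
        by (intro bexI[of _ "\<Union>i<n. U i"]) auto
    qed
    then show ?case
      using A(2) by auto
  qed
  then show ?thesis using e by blast
qed

section \<open>Twin classes\<close>

lemma finite_image_representatives: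
  assumes "finite (f ` A)"
  obtains R where "R \<subseteq> A" "finite R" "\<And>x. x \<in> A \<Longrightarrow> \<exists>r\<in>R. f r = f x"
proof -
  obtain R where "R \<subseteq> A" "finite R" "f ` A = f ` R"
    using finite_subset_image[OF assms order_refl] by auto
  then show ?thesis using that by (metis imageE imageI)
qed

text \<open>Equality of neighbourhoods up to null sets is the continuous analogue of the twin relation of a
  finite graph.
\<close>

definition twins :: "'a measure \<Rightarrow> ('a \<times> 'a) set \<Rightarrow> 'a \<Rightarrow> 'a \<Rightarrow> bool" where
  "twins M E x y \<longleftrightarrow> (AE z in M. (x, z) \<in> E \<longleftrightarrow> (y, z) \<in> E)"

text \<open>For a graphon with values 0 and 1 this is the value of the kernel \<open>P\<^sub>3\<^sup>N\<close>.
\<close>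

definition codegree :: "'a measure \<Rightarrow> ('a \<times> 'a) set \<Rightarrow> 'a \<Rightarrow> 'a \<Rightarrow> real" where
  "codegree M E x y = measure M (Pair x -` E \<inter> Pair y -` E)"

context prob_space
begin

lemma section_sets: "E \<in> sets (M \<Otimes>\<^sub>M M) \<Longrightarrow> Pair x -` E \<in> sets M"
  by (rule sets_Pair1)

lemma measurable_prob_section:
  assumes "Q \<in> sets (M \<Otimes>\<^sub>M M)"
  shows "(\<lambda>x. prob (Pair x -` Q)) \<in> borel_measurable M"
  unfolding measure_def using measurable_emeasure_Pair[OF assms] by measurable

lemma twins_iff_sym_diff:
  assumes E: "E \<in> sets (M \<Otimes>\<^sub>M M)"
  shows "twins M E x y \<longleftrightarrow> prob (sym_diff (Pair x -` E) (Pair y -` E)) = 0"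
proof -
  let ?S = "sym_diff (Pair x -` E) (Pair y -` E)"
  have S: "?S \<in> sets M" using section_sets[OF E] by auto
  have "prob ?S = 0 \<longleftrightarrow> (AE z in M. z \<notin> ?S)"
    by (rule prob_eq_0[OF S])
  also have "\<dots> \<longleftrightarrow> twins M E x y"
    unfolding twins_def by (intro AE_cong) auto
  finally show ?thesis by simp
qed

lemma AE_prob_le:
  assumes "AE x in M. x \<in> A \<longrightarrow> x \<in> B" "A \<in> sets M" "B \<in> sets M"
  shows "prob A \<le> prob B"
  using assms by (intro finite_measure_mono_AE) auto

text \<open>The gap that makes everything finite. If a generic point \<open>z\<close> is a neighbour of \<open>x\<close> and not of \<open>y\<close>, then \<open>z\<close> has no
  common neighbours with \<open>x\<close> but at least \<open>a\<close> of them with \<open>y\<close>. All of the latter lie in the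
  neighbourhood of \<open>y\<close> and almost all of them outside that of \<open>x\<close>, so the two neighbourhoods differ by
  at least \<open>a\<close>.
\<close>

lemma twins_if_neighbourhoods_close:
  assumes E: "E \<in> sets (M \<Otimes>\<^sub>M M)"
    and tf: "AE z in M. (x, z) \<in> E \<longrightarrow> codegree M E x z = 0"
            "AE z in M. (y, z) \<in> E \<longrightarrow> codegree M E y z = 0"
    and dense: "AE z in M. (x, z) \<notin> E \<longrightarrow> a \<le> codegree M E x z"
               "AE z in M. (y, z) \<notin> E \<longrightarrow> a \<le> codegree M E y z"
    and close: "prob (sym_diff (Pair x -` E) (Pair y -` E)) < a"
  shows "twins M E x y"
proof -
  have *: "AE z in M. (x, z) \<in> E \<longrightarrow> (y, z) \<in> E"
    if tf: "AE z in M. (x, z) \<in> E \<longrightarrow> codegree M E x z = 0"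
      and dense: "AE z in M. (y, z) \<notin> E \<longrightarrow> a \<le> codegree M E y z"
      and close: "prob (sym_diff (Pair x -` E) (Pair y -` E)) < a" for x y
    using tf dense
  proof eventually_elim
    case (elim z)
    have False if z: "(x, z) \<in> E" "(y, z) \<notin> E"
    proof -
      have "a \<le> prob (Pair y -` E \<inter> Pair z -` E)"
        using elim z by (simp add: codegree_def)
      also have "\<dots> \<le> prob ((Pair x -` E \<inter> Pair z -` E) \<union> sym_diff (Pair x -` E) (Pair y -` E))"
        using section_sets[OF E] by (intro finite_measure_mono) auto
      also have "\<dots> \<le> codegree M E x z + prob (sym_diff (Pair x -` E) (Pair y -` E))"
        unfolding codegree_def
        using section_sets[OF E] by (intro measure_Un_le) auto
      finally show False using elim z close by simp
    qed
    then show ?case by blast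
  qed
  have "sym_diff (Pair y -` E) (Pair x -` E) = sym_diff (Pair x -` E) (Pair y -` E)" by auto
  then have "AE z in M. (x, z) \<in> E \<longrightarrow> (y, z) \<in> E" "AE z in M. (y, z) \<in> E \<longrightarrow> (x, z) \<in> E"
    using *[OF tf(1) dense(2) close] *[OF tf(2) dense(1)] close by simp_all
  then show ?thesis
    unfolding twins_def by eventually_elim blast
qed

lemma measurable_twins [measurable]:
  assumes [measurable]: "E \<in> sets (M \<Otimes>\<^sub>M M)"
  shows "Measurable.pred M (\<lambda>x. twins M E r x)"
proof -
  have [measurable]: "Pair r -` E \<in> sets M" by (rule section_sets) fact
  have "twins M E r x \<longleftrightarrow> prob (Pair x -` {p \<in> space (M \<Otimes>\<^sub>M M). snd p \<in> Pair r -` E \<longleftrightarrow> p \<notin> E}) = 0"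
     if "x \<in> space M" for x
  proof -
    have "sym_diff (Pair r -` E) (Pair x -` E)
        = Pair x -` {p \<in> space (M \<Otimes>\<^sub>M M). snd p \<in> Pair r -` E \<longleftrightarrow> p \<notin> E}"
      using that sets.sets_into_space[OF \<open>E \<in> _\<close>] by (auto simp: space_pair_measure)
    then show ?thesis by (simp add: twins_iff_sym_diff)
  qed
  moreover have "Measurable.pred M (\<lambda>x. prob (Pair x -` {p \<in> space (M \<Otimes>\<^sub>M M). snd p \<in> Pair r -` E \<longleftrightarrow> p \<notin> E}) = 0)"
    using measurable_prob_section[of "{p \<in> space (M \<Otimes>\<^sub>M M). snd p \<in> Pair r -` E \<longleftrightarrow> p \<notin> E}"]
    by measurable
  ultimately show ?thesis
    by (subst measurable_cong) auto
qed

text \<open>First, \<open>E\<close> is approximated by a set \<open>U\<close> with finitely many sections, so well that the \<open>E\<close>-section and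
  the \<open>U\<close>-section differ by less than \<open>a / 2\<close> outside a set of measure less than \<open>a\<close>. Points outside it
  that share the same \<open>U\<close>-section have neighbourhoods at distance less than \<open>a\<close> and are twins by the
  gap lemma; hence finitely many twin classes cover everything but measure less than \<open>a\<close>.
  Secondly, the neighbourhood of any point is, inside each of these classes, everything or nothing.
  Two points with the same pattern of adjacency to the classes therefore have neighbourhoods that
  differ only outside the classes, that is by less than \<open>a\<close>, and they are again twins.
\<close>

lemma finitely_many_twin_classes:
  assumes E[measurable]: "E \<in> sets (M \<Otimes>\<^sub>M M)" and a: "a > 0"
    and sym: "AE x in M. AE y in M. (x, y) \<in> E \<longleftrightarrow> (y, x) \<in> E"
    and tf: "AE x in M. AE y in M. (x, y) \<in> E \<longrightarrow> codegree M E x y = 0"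
    and dense: "AE x in M. AE y in M. (x, y) \<notin> E \<longrightarrow> a \<le> codegree M E x y"
  shows "\<exists>R. finite R \<and> (AE x in M. \<exists>r\<in>R. twins M E r x)"
proof -
  interpret P: pair_prob_space M M ..
  define good where "good x \<longleftrightarrow> x \<in> space M \<and> (AE y in M. (x, y) \<in> E \<longrightarrow> codegree M E x y = 0) \<and>
    (AE y in M. (x, y) \<notin> E \<longrightarrow> a \<le> codegree M E x y)" for x
  have AE_good: "AE x in M. good x"
    unfolding good_def using tf dense by auto
  have close: "twins M E x y" if "good x" "good y" "prob (sym_diff (Pair x -` E) (Pair y -` E)) < a" for x y
    using that unfolding good_def by (intro twins_if_neighbourhoods_close[OF E]) auto
  \<comment> \<open>The precision is chosen for Markov's inequality: \<open>(a * a / 2) / (a / 2) = a\<close>.\<close>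
  obtain U where U: "U \<in> sets (M \<Otimes>\<^sub>M M)" "finite ((\<lambda>x. Pair x -` U) ` space M)"
    "P.prob (sym_diff E U) < a * a / 2"
    using approx_by_finitely_many_sections[OF P.P.finite_measure_axioms refl E, of "a*a/2"] a by auto
  note [measurable] = U(1)
  define D where "D x = prob (Pair x -` sym_diff E U)" for x
  have D_meas[measurable]: "D \<in> borel_measurable M" unfolding D_def by (rule measurable_prob_section) measurable
  have D_int: "(\<integral>x. D x \<partial>M) = P.prob (sym_diff E U)"
  proof -
    have "emeasure (M \<Otimes>\<^sub>M M) (sym_diff E U) = (\<integral>\<^sup>+x. ennreal (D x) \<partial>M)"
      unfolding D_def emeasure_eq_measure[symmetric] by (intro emeasure_pair_measure_alt) measurable
    then have "ennreal (P.prob (sym_diff E U)) = ennreal (\<integral>x. D x \<partial>M)"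
      by (subst nn_integral_eq_integral[symmetric])
        (auto simp: P.P.emeasure_eq_measure D_def intro!: integrable_const_bound[of _ 1])
    moreover have "0 \<le> expectation D" by (simp add: D_def)
    ultimately show ?thesis by simp
  qed
  define S where "S = {x \<in> space M. D x < a / 2}"
  have S_meas[measurable]: "S \<in> sets M" unfolding S_def by measurable
  have "prob (space M - S) < a"
  proof -
    have nonneg: "0 \<le> D x" and le1: "D x \<le> 1" for x by (simp_all add: D_def)
    have "integrable M D"
      using nonneg le1 D_meas by (intro integrable_const_bound[of _ 1]) simp_all
    then have "prob {x \<in> space M. D x \<ge> a / 2} \<le> (\<integral>x. D x \<partial>M) / (a / 2)"
      using a nonneg by (intro integral_Markov_inequality_measure[of _ _ "{}"]) simp_all
    also have "\<dots> < a" using U(3) a unfolding D_int by (simp add: field_simps)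
    also have "{x \<in> space M. D x \<ge> a / 2} = space M - S" unfolding S_def by auto
    finally show ?thesis .
  qed
  let ?S = "{x \<in> S. good x}"
  have "(\<lambda>x. Pair x -` U) ` ?S \<subseteq> (\<lambda>x. Pair x -` U) ` space M"
    unfolding S_def by auto
  then have fin: "finite ((\<lambda>x. Pair x -` U) ` ?S)"
    using U(2) finite_subset by blast
  obtain R where R: "R \<subseteq> ?S" "finite R"
      "\<And>x. x \<in> ?S \<Longrightarrow> \<exists>r\<in>R. Pair r -` U = Pair x -` U"
    by (rule finite_image_representatives[OF fin]) (rule that)
  have RS: "\<exists>r\<in>R. twins M E r x" if x: "x \<in> S" "good x" for x
  proof -
    obtain r where r: "r \<in> R" "Pair r -` U = Pair x -` U"
      using R(3)[of x] x by blast
    have "prob (sym_diff (Pair r -` E) (Pair x -` E))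
        \<le> prob (Pair r -` sym_diff E U \<union> Pair x -` sym_diff E U)"
      using r(2) by (intro finite_measure_mono) (auto intro!: section_sets)
    also have "\<dots> \<le> D r + D x" unfolding D_def
      by (intro measure_Un_le) (auto intro!: section_sets)
    also have "\<dots> < a" using r(1) R(1) x unfolding S_def by auto
    finally show ?thesis using r(1) R(1) x close[of r x] by auto
  qed
  \<comment> \<open>Everything outside the finitely many classes found so far has measure less than \<open>a\<close>.\<close>
  define T where "T = {x \<in> space M. \<exists>r\<in>R. twins M E r x}"
  have [measurable]: "T \<in> sets M" unfolding T_def using R(2) by measurable
  have T: "prob (space M - T) < a"
  proof -
    have "prob (space M - T) \<le> prob (space M - S)"
    proof (rule AE_prob_le)
      show "AE x in M. x \<in> space M - T \<longrightarrow> x \<in> space M - S"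
        using AE_good by eventually_elim (auto simp: T_def dest: RS)
    qed measurable
    also have "\<dots> < a" by fact
    finally show ?thesis .
  qed
  have "AE y in M. AE x in M. \<forall>r\<in>R. twins M E r x \<longrightarrow> ((x, y) \<in> E \<longleftrightarrow> (r, y) \<in> E)"
  proof (subst P.AE_commute[symmetric])
    have "Measurable.pred (M \<Otimes>\<^sub>M M) (\<lambda>p. \<forall>r\<in>R. twins M E r (fst p) \<longrightarrow> (p \<in> E \<longleftrightarrow> snd p \<in> Pair r -` E))"
      using R(2) section_sets[OF E] by measurable
    then show "{p \<in> space (M \<Otimes>\<^sub>M M). \<forall>r\<in>R. twins M E r (fst p) \<longrightarrow> ((fst p, snd p) \<in> E \<longleftrightarrow> (r, snd p) \<in> E)}
       \<in> sets (M \<Otimes>\<^sub>M M)" by (simp add: pred_def)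
    show "AE x in M. AE y in M. \<forall>r\<in>R. twins M E r x \<longrightarrow> ((x, y) \<in> E \<longleftrightarrow> (r, y) \<in> E)"
    proof (rule AE_I2, rule AE_finite_allI[OF R(2)])
      fix x r show "AE y in M. twins M E r x \<longrightarrow> ((x, y) \<in> E \<longleftrightarrow> (r, y) \<in> E)"
        by (cases "twins M E r x") (auto simp: twins_def elim: eventually_mono)
    qed
  qed
  \<comment> \<open>Symmetry turns this into a statement about the neighbourhood of \<open>y\<close>: within the twin class of
    \<open>r\<close> it is everything or nothing, depending on whether \<open>r\<close> and \<open>y\<close> are adjacent.\<close>
  then have pattern: "AE y in M. AE x in M. \<forall>r\<in>R. twins M E r x \<longrightarrow> ((y, x) \<in> E \<longleftrightarrow> (r, y) \<in> E)"
    using sym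
  proof eventually_elim
    case (elim y)
    show ?case using elim by eventually_elim blast
  qed
  define good' where "good' y \<longleftrightarrow> good y \<and>
    (AE x in M. \<forall>r\<in>R. twins M E r x \<longrightarrow> ((y, x) \<in> E \<longleftrightarrow> (r, y) \<in> E))" for y
  have AE_good': "AE y in M. good' y"
    unfolding good'_def using AE_good pattern by eventually_elim blast
  let ?p = "\<lambda>y. {r\<in>R. (r, y) \<in> E}"
  have fin': "finite (?p ` {y. good' y})"
    by (rule finite_subset[of _ "Pow R"]) (use R(2) in auto)
  obtain Q where Q: "Q \<subseteq> {y. good' y}" "finite Q"
      "\<And>y. y \<in> {y. good' y} \<Longrightarrow> \<exists>q\<in>Q. ?p q = ?p y"
    by (rule finite_image_representatives[OF fin']) (rule that)
  have "\<exists>q\<in>Q. twins M E q y" if y: "good' y" for y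
  proof -
    obtain q where q: "q \<in> Q" "?p q = ?p y"
      using Q(3) y by blast
    have gq: "good' q" using q Q by auto
    have "AE x in M. x \<in> sym_diff (Pair q -` E) (Pair y -` E) \<longrightarrow> x \<in> space M - T"
      using gq[unfolded good'_def, THEN conjunct2] y[unfolded good'_def, THEN conjunct2] AE_space
    proof eventually_elim
      case (elim x)
      have "(q, x) \<in> E \<longleftrightarrow> (y, x) \<in> E" if xT: "x \<in> T"
      proof -
        obtain r where "r \<in> R" "twins M E r x" using xT unfolding T_def by blast
        then show ?thesis using elim q(2) by blast
      qed
      then show ?case using elim by auto
    qed
    then have "prob (sym_diff (Pair q -` E) (Pair y -` E)) < a"
      using AE_prob_le[of "sym_diff (Pair q -` E) (Pair y -` E)" "space M - T"] T
      by (auto intro!: section_sets)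
    then show ?thesis using close gq y q(1) unfolding good'_def by blast
  qed
  then show ?thesis using Q(2) AE_good' by (intro exI[of _ Q]) (auto elim!: eventually_mono)
qed

section \<open>Step structure\<close>

lemma AE_witness:
  assumes "AE x in M. P x" "prob {x \<in> space M. Q x} > 0"
  obtains x where "x \<in> space M" "P x" "Q x"
proof -
  have "\<exists>x\<in>space M. P x \<and> Q x"
  proof (rule ccontr)
    assume "\<not> ?thesis"
    then have "AE x in M. x \<notin> {x \<in> space M. Q x}"
      using assms(1) by (auto elim: eventually_mono)
    moreover have "{x \<in> space M. Q x} \<in> events"
      using assms(2) measure_notin_sets by fastforce
    ultimately have "prob {x \<in> space M. Q x} = 0"
      by (simp add: prob_eq_0)
    then show False using assms(2) by simp
  qed
  then show ?thesis using that by blast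
qed

text \<open>The edge relation of the finite graph behind a step structure: parts \<open>i\<close> and \<open>j\<close> are joined if they
  are completely joined almost everywhere. Null parts are excluded, since the last condition holds
  vacuously for them and would create spurious edges, even loops.
\<close>

definition all_adjacent :: "('a \<times> 'a) set \<Rightarrow> ('a \<Rightarrow> nat) \<Rightarrow> nat \<Rightarrow> nat \<Rightarrow> bool" where
  "all_adjacent E c i j \<longleftrightarrow> prob {x \<in> space M. c x = i} > 0 \<and> prob {x \<in> space M. c x = j} > 0 \<and>
     (AE x in M. AE y in M. c x = i \<longrightarrow> c y = j \<longrightarrow> (x, y) \<in> E)"

lemma all_adjacent_sym:
  assumes [measurable]: "E \<in> sets (M \<Otimes>\<^sub>M M)" "c \<in> M \<rightarrow>\<^sub>M count_space UNIV"
    and sym: "AE x in M. AE y in M. (x, y) \<in> E \<longleftrightarrow> (y, x) \<in> E"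
    and B: "all_adjacent E c i j"
  shows "all_adjacent E c j i"
proof -
  interpret P: pair_prob_space M M ..
  have "AE y in M. AE x in M. c x = i \<longrightarrow> c y = j \<longrightarrow> (x, y) \<in> E"
  proof (subst P.AE_commute[symmetric])
    show "{p \<in> space (M \<Otimes>\<^sub>M M). c (fst p) = i \<longrightarrow> c (snd p) = j \<longrightarrow> (fst p, snd p) \<in> E}
       \<in> sets (M \<Otimes>\<^sub>M M)" by simp
  qed (use B in \<open>simp add: all_adjacent_def\<close>)
  then have "AE y in M. AE x in M. c y = j \<longrightarrow> c x = i \<longrightarrow> (y, x) \<in> E"
    using sym
  proof eventually_elim
    case (elim y)
    show ?case using elim by eventually_elim blast
  qed
  then show ?thesis using B by (simp add: all_adjacent_def)
qed

text \<open>Almost every \<open>x\<close> in part \<open>i\<close> and \<open>y\<close> in part \<open>j\<close> would be adjacent and have the whole part \<open>l\<close>, which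
  has positive measure, as common neighbours. The indices may coincide, so this also excludes loops.
\<close>

lemma all_adjacent_triangle_free:
  assumes [measurable]: "E \<in> sets (M \<Otimes>\<^sub>M M)" "c \<in> M \<rightarrow>\<^sub>M count_space UNIV"
    and tf: "AE x in M. AE y in M. (x, y) \<in> E \<longrightarrow> codegree M E x y = 0"
    and B: "all_adjacent E c i j" "all_adjacent E c j l" "all_adjacent E c i l"
  shows False
proof -
  have ij: "AE x in M. AE y in M. c x = i \<longrightarrow> c y = j \<longrightarrow> (x, y) \<in> E"
    and jl: "AE x in M. AE y in M. c x = j \<longrightarrow> c y = l \<longrightarrow> (x, y) \<in> E"
    and il: "AE x in M. AE y in M. c x = i \<longrightarrow> c y = l \<longrightarrow> (x, y) \<in> E"
    and pos: "prob {x \<in> space M. c x = i} > 0" "prob {x \<in> space M. c x = j} > 0"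
      "prob {x \<in> space M. c x = l} > 0"
    using B by (simp_all add: all_adjacent_def)
  have "AE x in M. (AE y in M. c x = i \<longrightarrow> c y = j \<longrightarrow> (x, y) \<in> E) \<and>
      (AE y in M. c x = i \<longrightarrow> c y = l \<longrightarrow> (x, y) \<in> E) \<and>
      (AE y in M. (x, y) \<in> E \<longrightarrow> codegree M E x y = 0)"
    using ij il tf by eventually_elim blast
  then obtain x where x: "c x = i" "AE y in M. c x = i \<longrightarrow> c y = j \<longrightarrow> (x, y) \<in> E"
      "AE y in M. c x = i \<longrightarrow> c y = l \<longrightarrow> (x, y) \<in> E"
      "AE y in M. (x, y) \<in> E \<longrightarrow> codegree M E x y = 0"
    using pos(1) by (rule AE_witness) blast
  have "AE y in M. (c y = j \<longrightarrow> codegree M E x y = 0) \<and>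
      (AE z in M. c y = j \<longrightarrow> c z = l \<longrightarrow> (y, z) \<in> E)"
    using x(2,4) jl by eventually_elim (use x(1) in blast)
  then obtain y where y: "c y = j" "c y = j \<longrightarrow> codegree M E x y = 0"
      "AE z in M. c y = j \<longrightarrow> c z = l \<longrightarrow> (y, z) \<in> E"
    using pos(2) by (rule AE_witness) blast
  have "AE z in M. z \<in> {z \<in> space M. c z = l} \<longrightarrow> z \<in> Pair x -` E \<inter> Pair y -` E"
    using x(3) y(3) by eventually_elim (use x(1) y(1) in auto)
  then have "prob {z \<in> space M. c z = l} \<le> codegree M E x y"
    unfolding codegree_def by (rule AE_prob_le) (auto intro!: section_sets)
  then show False using pos(3) y by simp
qed

text \<open>Colour every point by the index of its twin class. Then \<open>(x, y) \<in> E\<close> depends, up to null sets, only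
  on the colour of \<open>x\<close> and on \<open>y\<close>, and by symmetry also only on \<open>x\<close> and on the colour of \<open>y\<close>. Hence it is
  constant almost everywhere on each product of two colour classes.
\<close>

lemma step_structure:
  assumes E[measurable]: "E \<in> sets (M \<Otimes>\<^sub>M M)" and a: "a > 0"
    and sym: "AE x in M. AE y in M. (x, y) \<in> E \<longleftrightarrow> (y, x) \<in> E"
    and tf: "AE x in M. AE y in M. (x, y) \<in> E \<longrightarrow> codegree M E x y = 0"
    and dense: "AE x in M. AE y in M. (x, y) \<notin> E \<longrightarrow> a \<le> codegree M E x y"
  obtains k c where "c \<in> M \<rightarrow>\<^sub>M count_space UNIV" "\<And>x. c x \<le> k"
    "AE x in M. AE y in M. (x, y) \<in> E \<longleftrightarrow> all_adjacent E c (c x) (c y)"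
proof -
  interpret P: pair_prob_space M M ..
  obtain R where R: "finite R" "AE x in M. \<exists>r\<in>R. twins M E r x"
    using finitely_many_twin_classes[OF assms] by blast
  define k where "k = card R"
  obtain r where r: "bij_betw r {0..<k} R"
    unfolding k_def using ex_bij_betw_nat_finite[OF R(1)] by blast
  \<comment> \<open>The value \<open>k\<close> is a dummy colour for the null set of points without a twin among the
    representatives.\<close>
  define c where "c x = (LEAST i. i = k \<or> twins M E (r i) x)" for x
  have c_meas[measurable]: "c \<in> M \<rightarrow>\<^sub>M count_space UNIV"
    unfolding c_def by measurable
  have c_le: "c x \<le> k" for x
    unfolding c_def by (rule Least_le) simp
  have c_twins: "AE x in M. twins M E (r (c x)) x"
    using R(2)
  proof eventually_elim
    case (elim x)
    then obtain i where i: "i < k" "twins M E (r i) x"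
      using r unfolding bij_betw_def by (metis atLeastLessThan_iff imageE)
    then have "c x \<le> i" unfolding c_def by (intro Least_le) simp
    moreover have "c x = k \<or> twins M E (r (c x)) x"
      unfolding c_def by (rule LeastI_ex) blast
    ultimately show ?case using i(1) by auto
  qed
  have fst_dep: "AE x in M. AE y in M. (x, y) \<in> E \<longleftrightarrow> (r (c x), y) \<in> E"
    using c_twins unfolding twins_def
    by (auto elim!: eventually_mono)
  have snd_dep: "AE y in M. AE x in M. (y, x) \<in> E \<longleftrightarrow> (r (c x), y) \<in> E"
  proof (subst P.AE_commute[symmetric])
    have "Measurable.pred (M \<Otimes>\<^sub>M M) (\<lambda>p. snd p \<in> Pair (r i) -` E)" for i
      using section_sets[OF E] by measurable
    then have [measurable]: "Measurable.pred (M \<Otimes>\<^sub>M M) (\<lambda>p. snd p \<in> Pair (r (c (fst p))) -` E)"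
      by (rule measurable_compose_countable) measurable
    have [measurable]: "Measurable.pred (M \<Otimes>\<^sub>M M) (\<lambda>p. (snd p, fst p) \<in> E)"
      by measurable
    have "Measurable.pred (M \<Otimes>\<^sub>M M) (\<lambda>p. (snd p, fst p) \<in> E \<longleftrightarrow> snd p \<in> Pair (r (c (fst p))) -` E)"
      by measurable
    then show "{p \<in> space (M \<Otimes>\<^sub>M M). (snd p, fst p) \<in> E \<longleftrightarrow> (r (c (fst p)), snd p) \<in> E}
       \<in> sets (M \<Otimes>\<^sub>M M)" by (simp add: pred_def)
    show "AE x in M. AE y in M. (y, x) \<in> E \<longleftrightarrow> (r (c x), y) \<in> E"
      using fst_dep sym
    proof eventually_elim
      case (elim x)
      show ?case using elim by eventually_elim blast
    qed
  qed
  let ?A = "\<lambda>i. {x \<in> space M. c x = i}"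
  have const: "AE x in M. AE y in M. c x = i \<longrightarrow> c y = j \<longrightarrow> ((x, y) \<in> E \<longleftrightarrow> all_adjacent E c i j)"
    if pos: "prob (?A i) > 0" "prob (?A j) > 0" for i j
  proof -
    have "AE x in M. (AE y in M. (x, y) \<in> E \<longleftrightarrow> (r (c x), y) \<in> E) \<and>
        (AE y in M. (x, y) \<in> E \<longleftrightarrow> (r (c y), x) \<in> E)"
      using fst_dep snd_dep by eventually_elim blast
    \<comment> \<open>One generic point \<open>x0\<close> of part \<open>i\<close> suffices to see that the section of the representative
      \<open>r i\<close> is constant on part \<open>j\<close>.\<close>
    then obtain x0 where x0: "c x0 = i" "AE y in M. (x0, y) \<in> E \<longleftrightarrow> (r (c x0), y) \<in> E"
        "AE y in M. (x0, y) \<in> E \<longleftrightarrow> (r (c y), x0) \<in> E"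
      using pos(1) by (rule AE_witness) blast
    have ri: "AE y in M. c y = j \<longrightarrow> ((r i, y) \<in> E \<longleftrightarrow> (r j, x0) \<in> E)"
      using x0(2,3) by eventually_elim (use x0(1) in auto)
    have *: "AE x in M. AE y in M. c x = i \<longrightarrow> c y = j \<longrightarrow> ((x, y) \<in> E \<longleftrightarrow> (r j, x0) \<in> E)"
      using fst_dep
    proof eventually_elim
      case (elim x)
      show ?case using elim ri by eventually_elim auto
    qed
    show ?thesis
    proof (cases "(r j, x0) \<in> E")
      case True
      then have "all_adjacent E c i j" using * pos by (simp add: all_adjacent_def)
      then show ?thesis using * True by simp
    next
      case False
      have "\<not> all_adjacent E c i j"
      proof
        assume "all_adjacent E c i j"
        then have "AE x in M. AE y in M. c x = i \<longrightarrow> c y = j \<longrightarrow> (x, y) \<in> E"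
          by (simp add: all_adjacent_def)
        with * have "AE x in M. AE y in M. c x = i \<longrightarrow> c y \<noteq> j"
        proof eventually_elim
          case (elim x)
          show ?case using elim by eventually_elim (use False in blast)
        qed
        then obtain x where x: "c x = i" "AE y in M. c x = i \<longrightarrow> c y \<noteq> j"
          using pos(1) by (rule AE_witness) blast
        obtain y where "c x = i \<longrightarrow> c y \<noteq> j" "c y = j"
          using x(2) pos(2) by (rule AE_witness) blast
        then show False using x(1) by blast
      qed
      then show ?thesis using * False by simp
    qed
  qed
  have "AE x in M. \<forall>i\<in>{..k}. prob (?A i) = 0 \<longrightarrow> c x \<noteq> i"
  proof (rule AE_finite_allI)
    fix i show "AE x in M. prob (?A i) = 0 \<longrightarrow> c x \<noteq> i"
    proof (cases "prob (?A i) = 0")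
      case True
      then have "AE x in M. x \<notin> ?A i" by (subst (asm) prob_eq_0) auto
      then show ?thesis using AE_space by eventually_elim auto
    qed simp
  qed simp
  then have pos: "AE x in M. prob (?A (c x)) > 0"
    by eventually_elim (use c_le in \<open>auto simp: zero_less_measure_iff\<close>)
  have "AE x in M. AE y in M. \<forall>i\<in>{..k}. \<forall>j\<in>{..k}. prob (?A i) > 0 \<longrightarrow> prob (?A j) > 0 \<longrightarrow>
      c x = i \<longrightarrow> c y = j \<longrightarrow> ((x, y) \<in> E \<longleftrightarrow> all_adjacent E c i j)"
  proof -
    have "AE x in M. \<forall>i\<in>{..k}. \<forall>j\<in>{..k}. AE y in M. prob (?A i) > 0 \<longrightarrow> prob (?A j) > 0 \<longrightarrow>
      c x = i \<longrightarrow> c y = j \<longrightarrow> ((x, y) \<in> E \<longleftrightarrow> all_adjacent E c i j)"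
    proof (intro AE_finite_allI)
      fix i j
      show "AE x in M. AE y in M. prob (?A i) > 0 \<longrightarrow> prob (?A j) > 0 \<longrightarrow>
      c x = i \<longrightarrow> c y = j \<longrightarrow> ((x, y) \<in> E \<longleftrightarrow> all_adjacent E c i j)"
        using const[of i j] by (cases "prob (?A i) > 0 \<and> prob (?A j) > 0") auto
    qed auto
    then show ?thesis
      by eventually_elim (intro AE_finite_allI, auto)
  qed
  then have "AE x in M. AE y in M. (x, y) \<in> E \<longleftrightarrow> all_adjacent E c (c x) (c y)"
    using pos
  proof eventually_elim
    case (elim x)
    show ?case using elim(1) pos by eventually_elim (use c_le elim(2) in auto)
  qed
  then show ?thesis using that c_meas c_le by blast
qed

end

section \<open>Sampling from step graphons\<close>

lemma complete_measure_lebesgue_on: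
  assumes "S \<in> sets lebesgue"
  shows "complete_measure (lebesgue_on S)"
proof
  fix A B assume "B \<subseteq> A" "A \<in> null_sets (lebesgue_on S)"
  then have "A \<subseteq> S" "A \<in> null_sets lebesgue"
    using null_sets_restrict_space[OF assms] by auto
  moreover have "B \<in> sets lebesgue"
    using \<open>B \<subseteq> A\<close> \<open>A \<in> null_sets lebesgue\<close> null_sets_completion_subset by blast
  ultimately show "B \<in> sets (lebesgue_on S)"
    using \<open>B \<subseteq> A\<close> assms by (auto simp: sets_restrict_space_iff)
qed

lemma (in complete_measure) measurable_cong_AE:
  assumes g: "g \<in> M \<rightarrow>\<^sub>M N" and eq: "AE x in M. g x = f x" and sp: "f \<in> space M \<rightarrow> space N"
  shows "f \<in> M \<rightarrow>\<^sub>M N"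
proof (rule measurableI)
  fix A assume A: "A \<in> sets N"
  have "AE x in M. x \<in> g -` A \<inter> space M \<longleftrightarrow> x \<in> f -` A \<inter> space M"
    using eq by eventually_elim auto
  then show "f -` A \<inter> space M \<in> sets M"
    by (rule in_sets_AE) (use g A in \<open>auto intro: measurable_sets\<close>)
qed (use sp in auto)

lemma (in complete_measure) integral_cong_AE_complete:
  fixes f g :: "'a \<Rightarrow> real"
  assumes g: "g \<in> borel_measurable M" and eq: "AE x in M. g x = f x"
  shows "integral\<^sup>L M f = integral\<^sup>L M g"
  using assms measurable_cong_AE[OF g eq] by (intro integral_cong_AE) auto

text \<open>This transports null sets of the plane to null sets of sample sequences.
\<close>

lemma distr_PiM_pair:
  assumes M: "prob_space M" and ij: "i < n" "j < n" "i \<noteq> (j::nat)"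
  shows "distr (PiM {..<n} (\<lambda>_. M)) (M \<Otimes>\<^sub>M M) (\<lambda>x. (x i, x j)) = M \<Otimes>\<^sub>M M"
proof -
  interpret prob_space M by fact
  interpret F: finite_product_prob_space "\<lambda>_. M" "{..<n}" by standard auto
  show ?thesis
  proof (rule pair_measure_eqI[symmetric])
    fix A B assume A: "A \<in> sets M" and B: "B \<in> sets M"
    let ?X = "\<lambda>l. if l = i then A else if l = j then B else space M"
    have "emeasure (distr (PiM {..<n} (\<lambda>_. M)) (M \<Otimes>\<^sub>M M) (\<lambda>x. (x i, x j))) (A \<times> B)
        = emeasure (PiM {..<n} (\<lambda>_. M)) ((\<lambda>x. (x i, x j)) -` (A \<times> B) \<inter> space (PiM {..<n} (\<lambda>_. M)))"
      using A B ij by (intro emeasure_distr) auto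
    also have "(\<lambda>x. (x i, x j)) -` (A \<times> B) \<inter> space (PiM {..<n} (\<lambda>_. M)) = PiE {..<n} ?X"
    proof (intro equalityI subsetI)
      fix x assume x: "x \<in> PiE {..<n} ?X"
      then have X: "x l \<in> ?X l" if "l < n" for l using that by blast
      have "x l \<in> space M" if "l < n" for l
        using X[OF that] sets.sets_into_space[OF A] sets.sets_into_space[OF B] by (auto split: if_splits)
      then show "x \<in> (\<lambda>x. (x i, x j)) -` (A \<times> B) \<inter> space (PiM {..<n} (\<lambda>_. M))"
        using x X[OF ij(1)] X[OF ij(2)] ij(3) by (auto simp: space_PiM PiE_iff)
    qed (auto simp: space_PiM PiE_iff)
    also have "emeasure (PiM {..<n} (\<lambda>_. M)) \<dots> = (\<Prod>l<n. emeasure M (?X l))"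
      using A B by (intro F.measure_times) auto
    also have "\<dots> = (\<Prod>l\<in>{i, j}. emeasure M (?X l))"
      using ij by (intro prod.mono_neutral_right) (auto simp: emeasure_space_1)
    also have "\<dots> = emeasure M A * emeasure M B"
      using ij by simp
    finally show "emeasure M A * emeasure M B =
      emeasure (distr (PiM {..<n} (\<lambda>_. M)) (M \<Otimes>\<^sub>M M) (\<lambda>x. (x i, x j))) (A \<times> B)" by simp
  qed (auto intro: sigma_finite_measure_axioms)
qed

lemma integral_PiM_finite_colouring:
  fixes G :: "(nat \<Rightarrow> nat) \<Rightarrow> real"
  assumes M: "prob_space M" and c[measurable]: "c \<in> M \<rightarrow>\<^sub>M count_space UNIV" and k: "\<And>x. c x \<le> k"
    and G: "\<And>s t. (\<And>i. i < n \<Longrightarrow> s i = t i) \<Longrightarrow> G s = G t"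
  shows "(\<lambda>x. G (\<lambda>i. c (x i))) \<in> borel_measurable (PiM {..<n} (\<lambda>_. M))" (is ?meas)
    and "(LINT x|PiM {..<n} (\<lambda>_. M). G (\<lambda>i. c (x i))) =
      (\<Sum>s\<in>{..<n} \<rightarrow>\<^sub>E {..k}. G s * (\<Prod>i<n. measure M {x \<in> space M. c x = s i}))" (is ?int)
proof -
  interpret prob_space M by fact
  interpret F: finite_product_prob_space "\<lambda>_. M" "{..<n}" by standard auto
  let ?N = "PiM {..<n} (\<lambda>_. M)" and ?C = "{..<n} \<rightarrow>\<^sub>E {..k}"
  let ?X = "\<lambda>s. PiE {..<n} (\<lambda>i. {x \<in> space M. c x = s i})"
  have X: "?X s \<in> sets ?N" for s
    by (intro sets_PiM_I_finite) auto
  have prob: "measure ?N (?X s) = (\<Prod>i<n. measure M {x \<in> space M. c x = s i})" for s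
    by (rule F.prob_times) auto
  have fin: "finite ?C" by (intro finite_PiE) auto
  have eq: "G (\<lambda>i. c (x i)) = (\<Sum>s\<in>?C. G s * indicator (?X s) x)" if x: "x \<in> space ?N" for x
  proof -
    let ?s = "restrict (\<lambda>i. c (x i)) {..<n}"
    have "x \<in> ?X s \<longleftrightarrow> s = ?s" if "s \<in> ?C" for s
      using x that by (auto simp: space_PiM PiE_iff fun_eq_iff extensional_def)
    then have "(\<Sum>s\<in>?C. G s * indicator (?X s) x) = (\<Sum>s\<in>?C. if s = ?s then G s else 0)"
      by (intro sum.cong) (auto simp: indicator_def)
    also have "\<dots> = G ?s"
      using fin k by (subst sum.delta) auto
    also have "\<dots> = G (\<lambda>i. c (x i))" by (intro G) simp
    finally show ?thesis by simp
  qed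
  have "(\<lambda>x. \<Sum>s\<in>?C. G s * indicator (?X s) x) \<in> borel_measurable ?N"
    using X by measurable
  then show ?meas
    using eq by (subst measurable_cong) auto
  have "(LINT x|?N. G (\<lambda>i. c (x i))) = (LINT x|?N. (\<Sum>s\<in>?C. G s * indicator (?X s) x))"
    using eq by (intro Bochner_Integration.integral_cong) auto
  also have "\<dots> = (\<Sum>s\<in>?C. G s * measure ?N (?X s))"
    using X by (subst Bochner_Integration.integral_sum) (auto simp: less_top[symmetric])
  also have "\<dots> = (\<Sum>s\<in>?C. G s * (\<Prod>i<n. measure M {x \<in> space M. c x = s i}))"
    by (simp only: prob)
  finally show ?int .
qed

text \<open>The sampled graph depends on the sample points only through their colours, and the colours are
  independent. So the sampling statistics of a step graphon are determined by the weights of the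
  colour classes and the adjacency between colours; isomorphism of two step graphons that share these
  data follows by comparing the right-hand sides.
\<close>

lemma sampled_graph_prob_step:
  fixes c :: "real \<Rightarrow> nat"
  assumes c[measurable]: "c \<in> lebesgue_on {0..1} \<rightarrow>\<^sub>M count_space UNIV" and k: "\<And>x. c x \<le> k"
    and W: "AE p in lebesgue_on {0..1} \<Otimes>\<^sub>M lebesgue_on {0..1}.
      W (fst p) (snd p) = of_bool (B (c (fst p)) (c (snd p)))"
  shows "sampled_graph_prob W n F =
    (\<Sum>s\<in>{..<n} \<rightarrow>\<^sub>E {..k}.
       pmf (Pi_pmf (vertex_pairs n) False (\<lambda>(i, j). bernoulli_pmf (of_bool (B (s i) (s j))))) F *
       (\<Prod>i<n. measure lebesgue {x \<in> {0..1}. c x = s i}))"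
proof -
  let ?M = "lebesgue_on {0..1::real}"
  let ?N = "PiM {..<n} (\<lambda>_. ?M)"
  let ?G = "\<lambda>s. pmf (Pi_pmf (vertex_pairs n) False (\<lambda>(i, j). bernoulli_pmf (of_bool (B (s i) (s j))))) F"
  have M: "prob_space ?M"
    by (rule prob_spaceI) (simp add: emeasure_restrict_space)
  have meas: "measure ?M {x \<in> {0..1}. c x = v} = measure lebesgue {x \<in> {0..1}. c x = v}" for v
    by (rule measure_restrict_space) auto
  have fin: "finite (vertex_pairs n)"
    by (rule finite_subset[of _ "{..<n} \<times> {..<n}"]) (auto simp: vertex_pairs_def)
  have "AE x in ?N. \<forall>(i, j)\<in>vertex_pairs n. W (x i) (x j) = of_bool (B (c (x i)) (c (x j)))"
  proof (rule AE_finite_allI[OF fin])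
    fix e assume "e \<in> vertex_pairs n"
    then obtain i j where e: "e = (i, j)" "i < n" "j < n" "i \<noteq> j"
      unfolding vertex_pairs_def by auto
    have "AE p in distr ?N (?M \<Otimes>\<^sub>M ?M) (\<lambda>x. (x i, x j)).
        W (fst p) (snd p) = of_bool (B (c (fst p)) (c (snd p)))"
      using W unfolding distr_PiM_pair[OF M e(2-4)] .
    then have "AE x in ?N. W (x i) (x j) = of_bool (B (c (x i)) (c (x j)))"
      using e by (intro AE_distrD[where f="\<lambda>x. (x i, x j)" and P="\<lambda>p. W (fst p) (snd p) = of_bool (B (c (fst p)) (c (snd p)))", simplified])
         auto
    then show "AE x in ?N. case e of (i, j) \<Rightarrow> W (x i) (x j) = of_bool (B (c (x i)) (c (x j)))"
      by (simp add: e)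
  qed
  then have AE: "AE x in completion ?N. ?G (\<lambda>i. c (x i)) = pmf (sampled_graph_given W n x) F"
    unfolding AE_completion_iff
  proof eventually_elim
    case (elim x)
    then have "sampled_graph_given W n x = Pi_pmf (vertex_pairs n) False
        (\<lambda>(i, j). bernoulli_pmf (of_bool (B (c (x i)) (c (x j)))))"
      unfolding sampled_graph_given_def by (intro Pi_pmf_cong) auto
    then show ?case by simp
  qed
  have G: "?G s = ?G t" if "\<And>i. i < n \<Longrightarrow> s i = t i" for s t
    using that by (intro arg_cong[where f="\<lambda>p. pmf p F"] Pi_pmf_cong) (auto simp: vertex_pairs_def)
  note col = integral_PiM_finite_colouring[of ?M c k n ?G, OF M c k G]
  have "sampled_graph_prob W n F = (LINT x|completion ?N. ?G (\<lambda>i. c (x i)))"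
    unfolding sampled_graph_prob_def sample_points_def
    by (rule completion.integral_cong_AE_complete[OF _ AE]) (intro measurable_completion col(1))
  also have "\<dots> = (LINT x|?N. ?G (\<lambda>i. c (x i)))"
    by (intro integral_completion col(1))
  also have "\<dots> = (\<Sum>s\<in>{..<n} \<rightarrow>\<^sub>E {..k}. ?G s * (\<Prod>i<n. measure ?M {x \<in> {0..1}. c x = s i}))"
    using col(2) by simp
  also have "\<dots> = (\<Sum>s\<in>{..<n} \<rightarrow>\<^sub>E {..k}. ?G s * (\<Prod>i<n. measure lebesgue {x \<in> {0..1}. c x = s i}))"
    by (simp only: meas)
  finally show ?thesis .
qed

text \<open>The colour of \<open>x\<close> is the index of the first partial sum of the weights that exceeds \<open>x\<close>. No
  partial sum exceeds the point 1; capping the colour at \<open>k\<close> puts it into the last interval.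
\<close>

lemma interval_colouring:
  fixes p :: "nat \<Rightarrow> real"
  assumes p: "\<And>v. p v \<ge> 0" "(\<Sum>v\<le>k. p v) = 1"
  obtains c :: "real \<Rightarrow> nat" where "\<And>x. c x \<le> k"
    "\<And>v. v \<le> k \<Longrightarrow> is_interval {x \<in> {0..1}. c x = v}"
    "\<And>v. v \<le> k \<Longrightarrow> measure lebesgue {x \<in> {0..1}. c x = v} = p v"
    "c \<in> lebesgue_on {0..1} \<rightarrow>\<^sub>M count_space UNIV"
proof -
  define s where "s v = (\<Sum>u<v. p u)" for v
  define c where "c x = (LEAST v. v = k \<or> x < s (Suc v))" for x :: real
  have s0: "s 0 = 0" and s_Suc: "s (Suc v) = s v + p v" for v by (simp_all add: s_def)
  have s_mono: "s u \<le> s v" if "u \<le> v" for u v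
    unfolding s_def using that p(1) by (intro sum_mono2) auto
  have sk: "s (Suc k) = 1" using p(2) by (simp add: s_def lessThan_Suc_atMost)
  have c_le: "c x \<le> k" for x unfolding c_def by (rule Least_le) simp
  have c_less: "c x = k \<or> x < s (Suc (c x))" for x
    unfolding c_def by (rule LeastI_ex) blast
  have c_ge: "s (c x) \<le> x" if "x \<ge> 0" for x
  proof (cases "c x")
    case (Suc u)
    then have "\<not> (u = k \<or> x < s (Suc u))"
      unfolding c_def by (intro not_less_Least) simp
    then show ?thesis using Suc by simp
  qed (use that s0 in simp)
  have c_leI: "c x \<le> v" if "x < s (Suc v)" for x v
    unfolding c_def using that by (intro Least_le) simp
  have below: "{x \<in> {0..1}. c x = v} = {s v..<s (Suc v)}" if v: "v < k" for v
  proof (intro equalityI subsetI)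
    fix x assume "x \<in> {x \<in> {0..1}. c x = v}"
    then show "x \<in> {s v..<s (Suc v)}" using c_less[of x] c_ge[of x] v by auto
  next
    fix x assume x: "x \<in> {s v..<s (Suc v)}"
    have x01: "0 \<le> x" "x < 1"
      using x s_mono[of 0 v] s_mono[of "Suc v" "Suc k"] v s0 sk by auto
    have "c x \<le> v" using x c_leI by auto
    moreover have "\<not> c x < v"
      using c_less[of x] s_mono[of "Suc (c x)" v] v x by (auto simp: Suc_le_eq)
    ultimately show "x \<in> {x \<in> {0..1}. c x = v}" using x01 by auto
  qed
  have top: "{x \<in> {0..1}. c x = k} = {s k..1}"
  proof (intro equalityI subsetI)
    fix x assume "x \<in> {x \<in> {0..1}. c x = k}"
    then show "x \<in> {s k..1}" using c_ge[of x] by auto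
  next
    fix x assume x: "x \<in> {s k..1}"
    have "\<not> c x < k"
      using c_less[of x] s_mono[of "Suc (c x)" k] x by (auto simp: Suc_le_eq)
    then show "x \<in> {x \<in> {0..1}. c x = k}" using x s_mono[of 0 k] s0 c_le[of x] by auto
  qed
  have "is_interval {x \<in> {0..1}. c x = v}" if "v \<le> k" for v
    using that below[of v] top by (cases "v = k") (auto simp: is_interval_co is_interval_cc)
  moreover have "measure lebesgue {x \<in> {0..1}. c x = v} = p v" if "v \<le> k" for v
    using that below[of v] top sk s_Suc p(1)[of v] by (cases "v = k") auto
  moreover have "c \<in> lebesgue_on {0..1} \<rightarrow>\<^sub>M count_space UNIV"
  proof -
    have "c \<in> borel \<rightarrow>\<^sub>M count_space UNIV" unfolding c_def by measurable
    then show ?thesis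
      by (intro measurable_restrict_space1 measurable_completion) simp
  qed
  ultimately show ?thesis using that c_le by blast
qed

section \<open>Null sets in the unit square and the unit cube\<close>

abbreviation "unit_leb \<equiv> lebesgue_on {0..1::real}"

lemma prob_space_unit: "prob_space unit_leb"
  by (rule prob_spaceI) (simp add: emeasure_restrict_space)

lemma AE_lborel_imp_AE_unit:
  assumes "AE x in lborel. P x"
  shows "AE x in unit_leb. P x"
  using AE_completion[OF assms] by (subst AE_restrict_space_iff) (auto elim: eventually_mono)

lemma borel_measurable_unit_id [measurable]: "(\<lambda>x. x) \<in> unit_leb \<rightarrow>\<^sub>M borel"
  by (intro measurable_restrict_space1 measurable_completion) simp

lemma measurable_unit_square_id:
  "(\<lambda>p. p) \<in> unit_leb \<Otimes>\<^sub>M unit_leb \<rightarrow>\<^sub>M (borel :: (real \<times> real) measure)"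
proof -
  have "(\<lambda>p. (fst p, snd p)) \<in> unit_leb \<Otimes>\<^sub>M unit_leb \<rightarrow>\<^sub>M (borel :: real measure) \<Otimes>\<^sub>M (borel :: real measure)"
    by measurable
  then show ?thesis by (simp add: borel_prod)
qed

text \<open>The \<open>\<sigma>\<close>-algebra of the product of two Lebesgue measures is smaller than that of Lebesgue measure on
  the square, but every Lebesgue null set is covered by a Borel null set, to which Fubini applies.
\<close>

lemma AE_unit_square:
  fixes Q :: "real \<times> real \<Rightarrow> bool"
  assumes "AE p in lborel. p \<in> {0..1} \<times> {0..1} \<longrightarrow> Q p"
  shows "AE p in unit_leb \<Otimes>\<^sub>M unit_leb. Q p"
proof -
  interpret U: prob_space unit_leb by (rule prob_space_unit)
  interpret UU: pair_prob_space unit_leb unit_leb ..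
  obtain N where N: "N \<in> null_sets lborel" "{p. \<not> (p \<in> {0..1} \<times> {0..1} \<longrightarrow> Q p)} \<subseteq> N"
    using assms by (auto simp: eventually_ae_filter)
  have "AE p in lborel \<Otimes>\<^sub>M (lborel :: real measure). p \<notin> N"
    unfolding lborel_prod using N(1) by (rule AE_not_in)
  then have "AE x in lborel. AE y in lborel. (x, y) \<notin> N"
    by (rule lborel_pair.AE_pair)
  then have "AE x in unit_leb. AE y in unit_leb. (x, y) \<notin> N"
    by (intro AE_lborel_imp_AE_unit) (auto elim!: eventually_mono intro: AE_lborel_imp_AE_unit)
  moreover have "{p \<in> space (unit_leb \<Otimes>\<^sub>M unit_leb). p \<notin> N} \<in> sets (unit_leb \<Otimes>\<^sub>M unit_leb)"
  proof -
    have "(\<lambda>p. p) -` (- N) \<inter> space (unit_leb \<Otimes>\<^sub>M unit_leb) \<in> sets (unit_leb \<Otimes>\<^sub>M unit_leb)"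
      using N(1) by (intro measurable_sets[OF measurable_unit_square_id]) auto
    then show ?thesis by (simp add: vimage_def Int_def conj_commute)
  qed
  ultimately have "AE p in unit_leb \<Otimes>\<^sub>M unit_leb. p \<notin> N"
    by (intro UU.AE_pair_measure)
  then show ?thesis
    using AE_space by eventually_elim (use N(2) in \<open>auto simp: space_pair_measure\<close>)
qed

lemma AE_unit_square_swap:
  assumes "AE p in unit_leb \<Otimes>\<^sub>M unit_leb. Q p"
  shows "AE p in unit_leb \<Otimes>\<^sub>M unit_leb. Q (prod.swap p)"
proof -
  interpret U: prob_space unit_leb by (rule prob_space_unit)
  interpret UU: pair_prob_space unit_leb unit_leb ..
  have "AE p in distr (unit_leb \<Otimes>\<^sub>M unit_leb) (unit_leb \<Otimes>\<^sub>M unit_leb) (\<lambda>(x, y). (y, x)). Q p"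
    using assms by (subst (asm) UU.distr_pair_swap)
  from AE_distrD[OF _ this] show ?thesis
    by (simp add: prod.swap_def case_prod_beta measurable_pair_swap')
qed

lemma AE_unit_cube:
  fixes Q :: "real \<times> real \<times> real \<Rightarrow> bool"
  assumes "AE p in lborel. p \<in> {0..1} \<times> {0..1} \<times> {0..1} \<longrightarrow> Q p"
  shows "AE x in unit_leb. AE y in unit_leb. AE z in unit_leb. Q (x, y, z)"
proof -
  let ?Q = "\<lambda>p. p \<in> {0..1} \<times> {0..1} \<times> {0..1} \<longrightarrow> Q p"
  have "AE p in lborel \<Otimes>\<^sub>M (lborel :: (real \<times> real) measure). ?Q p"
    using assms by (simp only: lborel_prod)
  then have "AE x in lborel. AE q in (lborel :: (real \<times> real) measure). ?Q (x, q)"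
    by (rule lborel_pair.AE_pair)
  then have "AE x in lborel. AE y in lborel. AE z in lborel. ?Q (x, y, z)"
  proof eventually_elim
    case (elim x)
    then have "AE q in lborel \<Otimes>\<^sub>M (lborel :: real measure). ?Q (x, q)"
      by (simp only: lborel_prod)
    then show ?case by (rule lborel_pair.AE_pair)
  qed
  then have "AE x in unit_leb. AE y in unit_leb. AE z in unit_leb. ?Q (x, y, z)"
    by (intro AE_lborel_imp_AE_unit) (auto elim!: eventually_mono intro!: AE_lborel_imp_AE_unit)
  then have "AE x in unit_leb. x \<in> {0..1} \<longrightarrow> (AE y in unit_leb. y \<in> {0..1} \<longrightarrow> (AE z in unit_leb. z \<in> {0..1} \<longrightarrow> Q (x, y, z)))"
    by (auto elim!: eventually_mono)
  then show ?thesis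
    using AE_space[of unit_leb]
  proof eventually_elim
    case (elim x)
    then have "AE y in unit_leb. y \<in> {0..1} \<longrightarrow> (AE z in unit_leb. z \<in> {0..1} \<longrightarrow> Q (x, y, z))" by simp
    then show ?case
      using AE_space[of unit_leb]
    proof eventually_elim
      case (elim y)
      then have "AE z in unit_leb. z \<in> {0..1} \<longrightarrow> Q (x, y, z)" by simp
      then show ?case
        using AE_space[of unit_leb] by eventually_elim simp
    qed
  qed
qed

text \<open>The preimages of a planar null set under the three coordinate projections of the cube are null, by
  Fubini for Borel sets. It allows one to modify a graphon on a null set inside the triangle density.
\<close>

lemma AE_cube_projections:
  fixes N :: "(real \<times> real) set"
  assumes N: "N \<in> null_sets lborel"
  shows "AE (x, y, z) in lborel. (x, y) \<notin> N \<and> (y, z) \<notin> N \<and> (x, z) \<notin> N"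
proof -
  let ?P = "\<lambda>(x, y, z). (x, y) \<notin> N \<and> (y, z) \<notin> N \<and> (x, z) \<notin> N"
  have NB: "- N \<in> sets borel" using N by auto
  have "AE p in lborel \<Otimes>\<^sub>M (lborel :: real measure). p \<notin> N"
    unfolding lborel_prod using N by (rule AE_not_in)
  then have AE: "AE x in lborel. AE y in lborel. (x, y) \<notin> N"
    by (rule lborel_pair.AE_pair)
  have meas: "(\<lambda>p. (f p, g p)) -` (- N) \<in> sets borel"
    if "f \<in> borel_measurable borel" "g \<in> borel_measurable borel" for f g :: "'b::topological_space \<Rightarrow> real"
    using measurable_sets[OF borel_measurable_Pair[OF that] NB] by simp
  have [measurable]: "(\<lambda>p::real \<times> real \<times> real. (fst p, fst (snd p))) -` (- N) \<in> sets borel"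
    "(\<lambda>p::real \<times> real \<times> real. (fst (snd p), snd (snd p))) -` (- N) \<in> sets borel"
    "(\<lambda>p::real \<times> real \<times> real. (fst p, snd (snd p))) -` (- N) \<in> sets borel"
    by (intro meas borel_measurable_continuous_onI continuous_intros)+
  have [measurable]: "(\<lambda>q::real \<times> real. (fst q, snd q)) -` (- N) \<in> sets borel"
    "(\<lambda>q::real \<times> real. (x, fst q)) -` (- N) \<in> sets borel"
    "(\<lambda>q::real \<times> real. (x, snd q)) -` (- N) \<in> sets borel" for x
    by (intro meas borel_measurable_continuous_onI continuous_intros)+
  have inner: "AE q in lborel. ?P (x, q)" if x: "AE y in lborel. (x, y) \<notin> N" for x
  proof -
    have "AE q in lborel \<Otimes>\<^sub>M lborel. ?P (x, q)"
    proof (rule lborel_pair.AE_pair_measure)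
      have "{q. ?P (x, q)} = (\<lambda>q. (x, fst q)) -` (- N) \<inter> (\<lambda>q. (fst q, snd q)) -` (- N) \<inter> (\<lambda>q. (x, snd q)) -` (- N)"
        by auto
      also have "\<dots> \<in> sets borel" by measurable
      finally show "{q \<in> space (lborel \<Otimes>\<^sub>M lborel). ?P (x, q)} \<in> sets (lborel \<Otimes>\<^sub>M lborel)"
        unfolding lborel_prod by simp
      show "AE y in lborel. AE z in lborel. ?P (x, y, z)"
        using AE x
      proof eventually_elim
        case (elim y)
        show ?case using elim(1) x by eventually_elim (use elim(2) in auto)
      qed
    qed
    then show ?thesis by (simp only: lborel_prod)
  qed
  have "AE p in lborel \<Otimes>\<^sub>M lborel. ?P p"
  proof (rule lborel_pair.AE_pair_measure)
    have "{p. ?P p} = (\<lambda>p. (fst p, fst (snd p))) -` (- N) \<inter> (\<lambda>p. (fst (snd p), snd (snd p))) -` (- N) \<inter> (\<lambda>p. (fst p, snd (snd p))) -` (- N)"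
      by auto
    also have "\<dots> \<in> sets borel" by measurable
    finally show "{p \<in> space (lborel \<Otimes>\<^sub>M lborel). ?P p} \<in> sets (lborel \<Otimes>\<^sub>M lborel)"
      unfolding lborel_prod by simp
    show "AE x in lborel. AE q in lborel. ?P (x, q)"
      using AE by eventually_elim (rule inner)
  qed
  then show ?thesis by (simp only: lborel_prod)
qed

section \<open>Triangle-free graphons with positive codegrees\<close>

lemma square_sets: "({0..1} \<times> {0..1} :: (real \<times> real) set) \<in> sets lebesgue"
  by (intro sets_completionI_sets) (simp add: lborel_prod[symmetric] del: lborel_prod)

lemma cube_sets: "({0..1} \<times> {0..1} \<times> {0..1} :: (real \<times> real \<times> real) set) \<in> sets lebesgue"
  using lmeasurable_cbox[of "(0,0,0)" "(1,1,1) :: real \<times> real \<times> real"]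
  by (simp add: cbox_Pair_eq fmeasurableD)

lemma cube_lmeasurable: "({0..1} \<times> {0..1} \<times> {0..1} :: (real \<times> real \<times> real) set) \<in> lmeasurable"
  using lmeasurable_cbox[of "(0,0,0)" "(1,1,1) :: real \<times> real \<times> real"]
  by (simp add: cbox_Pair_eq)

text \<open>A Borel version has Borel sections and is measurable on the product space, so that Fubini and the
  results on twin classes apply. Clipping to the unit interval gives bounds everywhere.
\<close>

lemma graphon_borel_version:
  assumes "graphon W"
  obtains V :: "real \<times> real \<Rightarrow> real" where "V \<in> borel_measurable borel" "\<And>p. 0 \<le> V p" "\<And>p. V p \<le> 1"
    "AE p in lborel. p \<in> {0..1} \<times> {0..1} \<longrightarrow> V p = W (fst p) (snd p)"
proof -
  let ?g = "\<lambda>p. if p \<in> {0..1} \<times> {0..1} then case_prod W p else 0"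
  have "?g \<in> borel_measurable lebesgue"
    using assms square_sets by (intro borel_measurable_if_I) (auto simp: graphon_def)
  then obtain g where g: "g \<in> borel_measurable lborel" "AE p in lborel. ?g p = g p"
    using completion_ex_borel_measurable_real by blast
  have "AE p in lborel. p \<in> {0..1} \<times> {0..1} \<longrightarrow> max 0 (min 1 (g p)) = W (fst p) (snd p)"
    using g(2)
  proof eventually_elim
    case (elim p)
    show ?case
    proof
      assume p: "p \<in> {0..1} \<times> {0..1}"
      then have "W (fst p) (snd p) \<in> {0..1}" using assms by (auto simp: graphon_def)
      moreover have "g p = W (fst p) (snd p)" using elim p by (auto simp: case_prod_beta)
      ultimately show "max 0 (min 1 (g p)) = W (fst p) (snd p)" by auto
    qed
  qed
  then show ?thesis using that[of "\<lambda>p. max 0 (min 1 (g p))"] g(1) by auto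
qed

lemma triangle_free_AE:
  assumes V: "V \<in> borel_measurable borel" "\<And>p. 0 \<le> V p" "\<And>p. V p \<le> (1 :: real)"
    and VW: "AE p in lborel. p \<in> {0..1} \<times> {0..1} \<longrightarrow> V p = W (fst p) (snd p)"
    and tf: "triangle_free_graphon W"
  shows "AE x in unit_leb. AE y in unit_leb. AE z in unit_leb. V (x, y) * V (y, z) * V (x, z) = 0"
proof -
  let ?C = "{0..1} \<times> {0..1} \<times> {0..1} :: (real \<times> real \<times> real) set"
  let ?f = "\<lambda>(x, y, z). W x y * W y z * W x z" and ?g = "\<lambda>(x, y, z). V (x, y) * V (y, z) * V (x, z)"
  interpret C: complete_measure "lebesgue_on ?C"
    by (rule complete_measure_lebesgue_on) (rule cube_sets)
  interpret F: finite_measure "lebesgue_on ?C"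
    by (rule finite_measure_lebesgue_on) (rule cube_lmeasurable)
  obtain N where N: "N \<in> null_sets lborel"
      "{p. \<not> (p \<in> {0..1} \<times> {0..1} \<longrightarrow> V p = W (fst p) (snd p))} \<subseteq> N"
    using VW by (auto simp: eventually_ae_filter)
  have V_eq: "V (u, v) = W u v" if "u \<in> {0..1}" "v \<in> {0..1}" "(u, v) \<notin> N" for u v
    using subsetD[OF N(2), of "(u, v)"] that by auto
  have "AE p in lborel. p \<in> ?C \<longrightarrow> ?g p = ?f p"
    using AE_cube_projections[OF N(1)]
  proof eventually_elim
    case (elim p)
    obtain x y z where p: "p = (x, y, z)" by (cases p) auto
    show ?case using elim V_eq unfolding p by auto
  qed
  then have eq: "AE p in lebesgue_on ?C. ?g p = ?f p"
    using cube_sets by (subst AE_restrict_space_iff) (auto intro: AE_completion)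
  have "?g \<in> borel_measurable borel"
  proof -
    have V_comp: "(\<lambda>p. V (f p, g p)) \<in> borel_measurable borel"
      if "continuous_on UNIV f" "continuous_on UNIV g" for f g :: "real \<times> real \<times> real \<Rightarrow> real"
      using that by (intro measurable_compose[OF _ V(1)] borel_measurable_continuous_onI continuous_intros)
    have "(\<lambda>p. V (fst p, fst (snd p)) * V (fst (snd p), snd (snd p)) * V (fst p, snd (snd p)))
      \<in> borel_measurable (borel :: (real \<times> real \<times> real) measure)"
      by (intro borel_measurable_times V_comp continuous_intros)
    also have "(\<lambda>p. V (fst p, fst (snd p)) * V (fst (snd p), snd (snd p)) * V (fst p, snd (snd p))) = ?g"
      by (auto simp: fun_eq_iff)
    finally show ?thesis .
  qed
  then have gm: "?g \<in> borel_measurable (lebesgue_on ?C)"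
    by (intro measurable_restrict_space1 measurable_completion) simp
  have "integral\<^sup>L (lebesgue_on ?C) ?g = 0"
    using C.integral_cong_AE_complete[OF gm eq] tf unfolding triangle_free_graphon_def by simp
  moreover have "integrable (lebesgue_on ?C) ?g"
    using gm V by (intro F.integrable_const_bound[of _ 1]) (auto simp: abs_mult intro!: AE_I2 mult_le_one)
  ultimately have "AE p in lebesgue_on ?C. ?g p = 0"
    using V by (subst (asm) integral_nonneg_eq_0_iff_AE) auto
  then have "AE p in lborel. p \<in> ?C \<longrightarrow> ?g p = 0"
    using cube_sets by (subst (asm) AE_restrict_space_iff) (auto simp: AE_completion_iff)
  from AE_unit_cube[OF this] show ?thesis by simp
qed

lemma P3N_cong_AE:
  assumes "f \<in> borel_measurable unit_leb" "g \<in> borel_measurable unit_leb"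
    and "AE z in unit_leb. f z = W x z" "AE z in unit_leb. g z = W y z"
  shows "P3N W x y = (LINT z|unit_leb. f z * g z)"
proof -
  interpret C: complete_measure unit_leb
    by (rule complete_measure_lebesgue_on) simp
  have "AE z in unit_leb. f z * g z = W x z * W y z"
    using assms(3,4) by eventually_elim simp
  then show ?thesis
    unfolding P3N_def using assms(1,2) by (intro C.integral_cong_AE_complete) auto
qed

lemma AE_of_full_measure:
  fixes Q :: "real \<times> real \<Rightarrow> bool"
  assumes "measure lebesgue {p \<in> {0..1} \<times> {0..1}. Q p} = 1"
  shows "AE p in lborel. p \<in> {0..1} \<times> {0..1} \<longrightarrow> Q p"
proof -
  let ?S = "{p \<in> {0..1} \<times> {0..1}. Q p}"
  have box: "{0..1} \<times> {0..1} = cbox (0, 0) (1 :: real, 1 :: real)" by (simp add: cbox_Pair_eq)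
  have S: "?S \<in> sets lebesgue" using assms measure_notin_sets by fastforce
  have "measure lebesgue ({0..1} \<times> {0..1} - ?S) = measure lebesgue ({0..1} \<times> {0..1} :: (real \<times> real) set) - measure lebesgue ?S"
  proof (rule measurable_measure_Diff)
    show "({0..1} \<times> {0..1} :: (real \<times> real) set) \<in> lmeasurable" unfolding box by (rule lmeasurable_cbox)
  qed (use S in auto)
  moreover have "measure lebesgue ({0..1} \<times> {0..1} :: (real \<times> real) set) = 1"
    unfolding box by (simp add: content_Pair)
  ultimately have "measure lebesgue ({0..1} \<times> {0..1} - ?S) = 0"
    using assms by simp
  then have "negligible ({0..1} \<times> {0..1} - ?S)"
    unfolding negligible_iff_measure using S lmeasurable_cbox[of "(0, 0)" "(1 :: real, 1 :: real)"]
    unfolding box by (blast intro: fmeasurable_Diff)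
  then have "AE p in lebesgue. p \<notin> {0..1} \<times> {0..1} - ?S"
    unfolding negligible_iff_null_sets by (rule AE_not_in)
  then show ?thesis
    unfolding AE_completion_iff by eventually_elim auto
qed

text \<open>Almost every pair with \<open>W x y > 0\<close> has \<open>P3N W x y = 0 < a\<close>, because triangles have measure zero; so
  \<open>W x y = 1\<close> there. Thus the graphon is the indicator of a set \<open>E\<close> up to a null set, pairs in \<open>E\<close> have
  codegree 0 and all other pairs have codegree at least \<open>a\<close>, which is the situation of
  \<open>step_structure\<close>.
\<close>

lemma dense_triangle_free_graphon_step:
  assumes W: "graphon W" and tf: "triangle_free_graphon W" and a: "a > 0"
    and meas: "measure lebesgue {(x, y) \<in> {0..1} \<times> {0..1}. W x y < 1 \<longrightarrow> P3N W x y \<ge> a} = 1"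
  shows "\<exists>(k :: nat) (c :: real \<Rightarrow> nat) B. c \<in> unit_leb \<rightarrow>\<^sub>M count_space UNIV \<and> (\<forall>x. c x \<le> k) \<and>
    (\<forall>i j. B i j \<longrightarrow> B j i) \<and> (\<forall>i j l. B i j \<longrightarrow> B j l \<longrightarrow> \<not> B i l) \<and>
    (AE p in unit_leb \<Otimes>\<^sub>M unit_leb. W (fst p) (snd p) = of_bool (B (c (fst p)) (c (snd p))))"
proof -
  interpret U: prob_space unit_leb by (rule prob_space_unit)
  interpret UU: pair_prob_space unit_leb unit_leb ..
  obtain V where V: "V \<in> borel_measurable borel" "\<And>p. 0 \<le> V p" "\<And>p. V p \<le> (1 :: real)"
    and VW0: "AE p in lborel. p \<in> {0..1} \<times> {0..1} \<longrightarrow> V p = W (fst p) (snd p)"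
    by (rule graphon_borel_version[OF W]) (rule that)
  note VW = AE_unit_square[OF VW0]
  note VW_swap = AE_unit_square_swap[OF VW]
  have V_meas[measurable]: "V \<in> borel_measurable (unit_leb \<Otimes>\<^sub>M unit_leb)"
    using measurable_compose[OF measurable_unit_square_id V(1)] .
  have V_row[measurable]: "(\<lambda>z. V (x, z)) \<in> borel_measurable unit_leb" if "x \<in> {0..1}" for x
    using measurable_compose[OF measurable_Pair1' V_meas, of x] that by simp
  have dense: "AE p in unit_leb \<Otimes>\<^sub>M unit_leb. W (fst p) (snd p) < 1 \<longrightarrow> a \<le> P3N W (fst p) (snd p)"
  proof (intro AE_unit_square AE_of_full_measure)
    have "{p \<in> {0..1} \<times> {0..1}. W (fst p) (snd p) < 1 \<longrightarrow> a \<le> P3N W (fst p) (snd p)}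
      = {(x, y) \<in> {0..1} \<times> {0..1}. W x y < 1 \<longrightarrow> P3N W x y \<ge> a}" by auto
    then show "measure lebesgue {p \<in> {0..1} \<times> {0..1}. W (fst p) (snd p) < 1 \<longrightarrow> a \<le> P3N W (fst p) (snd p)} = 1"
      using meas by (simp only:)
  qed
  have rowV: "AE x in unit_leb. x \<in> {0..1} \<and> (AE z in unit_leb. V (x, z) = W x z)"
    using UU.AE_pair[OF VW] AE_space by eventually_elim auto
  have dich: "AE x in unit_leb. AE y in unit_leb.
    (V (x, y) = 1 \<and> P3N W x y = 0) \<or> (V (x, y) = 0 \<and> a \<le> P3N W x y)"
    using rowV UU.AE_pair[OF dense] triangle_free_AE[OF V VW0 tf]
  proof eventually_elim
    case (elim x)
    show ?case
      using elim(1)[THEN conjunct2] rowV elim(2,3)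
    proof eventually_elim
      case (elim y)
      show ?case
      proof (cases "V (x, y) = 0")
        case True
        then show ?thesis using elim by simp
      next
        case False
        have "P3N W x y = (LINT z|unit_leb. V (x, z) * V (y, z))"
          using elim(2) \<open>x \<in> {0..1} \<and> _\<close> by (intro P3N_cong_AE V_row) auto
        also have "\<dots> = (LINT z|unit_leb. 0)"
        proof (rule integral_cong_AE)
          show "AE z in unit_leb. V (x, z) * V (y, z) = 0"
            using elim(4) by eventually_elim (use False in auto)
        qed (use V_row elim(2) \<open>x \<in> {0..1} \<and> _\<close> in auto)
        finally have "P3N W x y = 0" by simp
        moreover have "W x y \<ge> 1" using elim(3) calculation a by (cases "W x y < 1") auto
        ultimately show ?thesis using elim(1) V(3)[of "(x, y)"] by simp
      qed
    qed
  qed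
  define E where "E = {p \<in> space (unit_leb \<Otimes>\<^sub>M unit_leb). V p = 1}"
  have E[measurable]: "E \<in> sets (unit_leb \<Otimes>\<^sub>M unit_leb)" unfolding E_def by measurable
  have E_iff: "(x, y) \<in> E \<longleftrightarrow> V (x, y) = 1" if "x \<in> {0..1}" "y \<in> {0..1}" for x y
    using that by (auto simp: E_def space_pair_measure)
  have row: "AE x in unit_leb. x \<in> {0..1} \<and> (AE z in unit_leb. indicator (Pair x -` E) z = W x z)"
    using rowV dich
  proof eventually_elim
    case (elim x)
    have "AE z in unit_leb. indicator (Pair x -` E) z = W x z"
      using elim(1)[THEN conjunct2] elim(2) AE_space
      by eventually_elim (use elim(1) E_iff in \<open>auto simp: indicator_def\<close>)
    then show ?case using elim by blast
  qed
  have codeg: "AE x in unit_leb. AE y in unit_leb. codegree unit_leb E x y = P3N W x y"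
    using row
  proof eventually_elim
    case (elim x)
    note x = elim
    show ?case using row
    proof eventually_elim
      case (elim y)
      have "P3N W x y = (LINT z|unit_leb. indicator (Pair x -` E) z * indicator (Pair y -` E) z)"
        using x elim U.section_sets[OF E] by (intro P3N_cong_AE) auto
      also have "\<dots> = (LINT z|unit_leb. indicator (Pair x -` E \<inter> Pair y -` E) z)"
        by (simp add: indicator_inter_arith)
      also have "\<dots> = codegree unit_leb E x y"
        unfolding codegree_def
        using U.section_sets[OF E] sets.sets_into_space[OF U.section_sets[OF E]]
        by (simp add: Int_absorb2 le_infI1)
      finally show ?case by simp
    qed
  qed
  have sym: "AE x in unit_leb. AE y in unit_leb. (x, y) \<in> E \<longleftrightarrow> (y, x) \<in> E"
    using UU.AE_pair[OF VW] UU.AE_pair[OF VW_swap] AE_space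
  proof eventually_elim
    case (elim x)
    show ?case using elim(1,2) AE_space
      by eventually_elim (use elim(3) W E_iff in \<open>auto simp: graphon_def\<close>)
  qed
  have tfE: "AE x in unit_leb. AE y in unit_leb. (x, y) \<in> E \<longrightarrow> codegree unit_leb E x y = 0"
    using dich codeg AE_space
  proof eventually_elim
    case (elim x)
    show ?case using elim(1,2) AE_space
      by eventually_elim (use elim(3) E_iff in auto)
  qed
  have denseE: "AE x in unit_leb. AE y in unit_leb. (x, y) \<notin> E \<longrightarrow> a \<le> codegree unit_leb E x y"
    using dich codeg AE_space
  proof eventually_elim
    case (elim x)
    show ?case using elim(1,2) AE_space
      by eventually_elim (use elim(3) E_iff in auto)
  qed
  obtain k c where c[measurable]: "c \<in> unit_leb \<rightarrow>\<^sub>M count_space UNIV" and k: "\<And>x. c x \<le> k"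
    and step: "AE x in unit_leb. AE y in unit_leb. (x, y) \<in> E \<longleftrightarrow> U.all_adjacent E c (c x) (c y)"
    by (rule U.step_structure[OF E a sym tfE denseE]) (rule that)
  let ?B = "U.all_adjacent E c"
  have "AE x in unit_leb. AE y in unit_leb. V (x, y) = of_bool (?B (c x) (c y))"
    using dich step AE_space
  proof eventually_elim
    case (elim x)
    show ?case using elim(1,2) AE_space
      by eventually_elim (use elim(3) E_iff in auto)
  qed
  then have "AE p in unit_leb \<Otimes>\<^sub>M unit_leb. V p = of_bool (?B (c (fst p)) (c (snd p)))"
  proof (intro UU.AE_pair_measure)
    have "Measurable.pred (unit_leb \<Otimes>\<^sub>M unit_leb) (\<lambda>p. V p = of_bool (?B i j))" for i j
      by measurable
    then have "Measurable.pred (unit_leb \<Otimes>\<^sub>M unit_leb) (\<lambda>p. V p = of_bool (?B i (c (snd p))))" for i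
      by (rule measurable_compose_countable) measurable
    then have "Measurable.pred (unit_leb \<Otimes>\<^sub>M unit_leb) (\<lambda>p. V p = of_bool (?B (c (fst p)) (c (snd p))))"
      by (rule measurable_compose_countable) measurable
    then show "{p \<in> space (unit_leb \<Otimes>\<^sub>M unit_leb). V p = of_bool (?B (c (fst p)) (c (snd p)))}
      \<in> sets (unit_leb \<Otimes>\<^sub>M unit_leb)" by (simp add: pred_def)
  qed simp
  then have "AE p in unit_leb \<Otimes>\<^sub>M unit_leb. W (fst p) (snd p) = of_bool (?B (c (fst p)) (c (snd p)))"
    using VW by eventually_elim simp
  then show ?thesis
    using c k U.all_adjacent_sym[OF E c sym] U.all_adjacent_triangle_free[OF E c tfE]
    by (intro exI[of _ k] exI[of _ c] exI[of _ ?B] conjI) blast+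
qed

lemma P3N_nonneg:
  assumes "graphon W" "x \<in> {0..1}" "y \<in> {0..1}"
  shows "0 \<le> P3N W x y"
  unfolding P3N_def using assms by (intro integral_nonneg_AE AE_I2) (auto simp: graphon_def)

text \<open>Zero is always an admissible value. If no positive value is admissible, then zero is the greatest
  one; hence a nonzero \<open>a_val W\<close> yields some positive admissible value, irrespective of
  whether a greatest one exists.
\<close>

lemma a_val_nonzero_imp_positive_admissible:
  assumes W: "graphon W" and nz: "a_val W \<noteq> 0"
  shows "\<exists>a>0. measure lebesgue {(x, y) \<in> {0..1} \<times> {0..1}. W x y < 1 \<longrightarrow> P3N W x y \<ge> a} = 1"
proof (rule ccontr)
  assume no: "\<not> ?thesis"
  let ?Q = "\<lambda>a. measure lebesgue {(x, y) \<in> {0..1} \<times> {0..1}. W x y < 1 \<longrightarrow> P3N W x y \<ge> a} = 1"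
  have "{(x, y) \<in> {0..1} \<times> {0..1}. W x y < 1 \<longrightarrow> P3N W x y \<ge> 0} = cbox (0, 0) (1, 1)"
    using P3N_nonneg[OF W] by (auto simp: cbox_Pair_eq)
  then have "?Q 0"
    by (simp add: content_Pair)
  moreover have "a \<le> 0" if "?Q a" for a
    using no that by (meson not_le)
  ultimately have "a_val W = 0"
    unfolding a_val_def by (intro Greatest_equality) auto
  then show False using nz by simp
qed

theorem theorem4p7:
  fixes W :: "real \<Rightarrow> real \<Rightarrow> real"
  assumes "graphon W" and "triangle_free_graphon W"
  shows "a_val W = 0 \<or>
    (\<exists>(G :: nat pair_pre_digraph) \<mu> I.
       vertex_weighted_graph G \<mu> \<and> triangle_free_graph G \<and>
       weight_partition G \<mu> I \<and> graphon_isomorphic W (step_graphon G I))"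
proof (cases "a_val W = 0")
  case False
  then obtain a where a: "a > 0"
    "measure lebesgue {(x, y) \<in> {0..1} \<times> {0..1}. W x y < 1 \<longrightarrow> P3N W x y \<ge> a} = 1"
    using a_val_nonzero_imp_positive_admissible[OF assms(1)] by blast
  obtain k :: nat and c :: "real \<Rightarrow> nat" and B where c: "c \<in> unit_leb \<rightarrow>\<^sub>M count_space UNIV" and "\<forall>x. c x \<le> k"
    and "\<forall>i j. B i j \<longrightarrow> B j i" and "\<forall>i j l. B i j \<longrightarrow> B j l \<longrightarrow> \<not> B i l"
    and W: "AE p in unit_leb \<Otimes>\<^sub>M unit_leb. W (fst p) (snd p) = of_bool (B (c (fst p)) (c (snd p)))"
    using dense_triangle_free_graphon_step[OF assms a] by (elim exE conjE) (rule that)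
  then have k: "\<And>x. c x \<le> k" and sym: "\<And>i j. B i j \<Longrightarrow> B j i"
    and tf: "\<And>i j l. B i j \<Longrightarrow> B j l \<Longrightarrow> \<not> B i l"
    by blast+
  note [measurable] = c
  interpret U: prob_space unit_leb by (rule prob_space_unit)
  define p where "p v = measure lebesgue {x \<in> {0..1}. c x = v}" for v
  have p_eq: "p v = U.prob {x \<in> {0..1}. c x = v}" for v
    unfolding p_def by (rule measure_restrict_space[symmetric]) auto
  have p_nonneg: "p v \<ge> 0" for v by (simp add: p_def)
  have p_0: "p v = 0" if "v > k" for v
  proof -
    have "c x \<noteq> v" for x using k[of x] that by simp
    then show ?thesis by (simp add: p_def)
  qed
  have p_sum: "(\<Sum>v\<le>k. p v) = 1"
  proof -
    have "{x \<in> {0..1}. c x = v} \<in> sets unit_leb" for v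
    proof -
      have "{x \<in> space unit_leb. c x = v} \<in> sets unit_leb" by measurable
      then show ?thesis by simp
    qed
    then have "(\<Sum>v\<le>k. p v) = U.prob (\<Union>v\<le>k. {x \<in> {0..1}. c x = v})"
      unfolding p_eq by (intro U.finite_measure_finite_Union[symmetric]) (auto simp: disjoint_family_on_def)
    also have "(\<Union>v\<le>k. {x \<in> {0..1}. c x = v}) = space unit_leb" using k by auto
    finally show ?thesis using U.prob_space by simp
  qed
  define \<mu> where "\<mu> = embed_pmf p"
  have \<mu>: "pmf \<mu> v = p v" for v
    unfolding \<mu>_def
  proof (rule pmf_embed_pmf)
    have "(\<integral>\<^sup>+v. ennreal (p v) \<partial>count_space UNIV) = (\<Sum>v\<le>k. ennreal (p v))"
      using p_0 by (intro nn_integral_count_space') (auto simp: not_le)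
    also have "\<dots> = 1" using p_nonneg p_sum by (simp add: sum_ennreal)
    finally show "(\<integral>\<^sup>+v. ennreal (p v) \<partial>count_space UNIV) = 1" .
  qed (rule p_nonneg)
  obtain d :: "real \<Rightarrow> nat" where d: "\<And>x. d x \<le> k"
    "\<And>v. v \<le> k \<Longrightarrow> is_interval {x \<in> {0..1}. d x = v}"
    "\<And>v. v \<le> k \<Longrightarrow> measure lebesgue {x \<in> {0..1}. d x = v} = p v"
    and d_meas: "d \<in> unit_leb \<rightarrow>\<^sub>M count_space UNIV"
    using interval_colouring[of p k, OF p_nonneg p_sum] by blast
  define G where "G = \<lparr>pverts = {..k}, parcs = {(i, j). i \<le> k \<and> j \<le> k \<and> B i j}\<rparr>"
  define I where "I v = {x \<in> {0..1}. d x = v}" for v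
  have pv: "pverts G = {..k}" and pa: "parcs G = {(i, j). i \<le> k \<and> j \<le> k \<and> B i j}"
    by (simp_all add: G_def)
  have "pair_graph G"
  proof
    show "finite (parcs G)"
      by (rule finite_subset[of _ "{..k} \<times> {..k}"]) (auto simp: pa)
    show "symmetric (with_proj G)"
      using sym by (auto simp: Digraph.symmetric_def sym_def pa arcs_ends_def arc_to_ends_def with_proj_def)
    have "\<not> B i i" for i
      using tf[of i i i] by blast
    then show "fst e \<noteq> snd e" if "e \<in> parcs G" for e
      using that by (auto simp: pa)
  qed (auto simp: pv pa)
  then have "vertex_weighted_graph G \<mu>"
    using p_0 by (auto simp: vertex_weighted_graph_def set_pmf_eq \<mu> pv not_le[symmetric])
  moreover have "triangle_free_graph G"
    unfolding triangle_free_graph_def using tf by (auto simp: pa)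
  moreover have "weight_partition G \<mu> I"
    unfolding weight_partition_def I_def using d(1,2,3)
    by (auto simp: pv \<mu> disjoint_family_on_def)
  moreover have "graphon_isomorphic W (step_graphon G I)"
    unfolding graphon_isomorphic_def
  proof (intro allI)
    fix n F
    have step: "step_graphon G I x y = of_bool (B (d x) (d y))" if "x \<in> {0..1}" "y \<in> {0..1}" for x y
      using that d(1) by (auto simp: step_graphon_def pa I_def)
    have "AE q in unit_leb \<Otimes>\<^sub>M unit_leb. step_graphon G I (fst q) (snd q) = of_bool (B (d (fst q)) (d (snd q)))"
      using AE_space by eventually_elim (auto simp: space_pair_measure step)
    note prob_step = sampled_graph_prob_step[OF d_meas d(1) this, of n F]
    show "sampled_graph_prob W n F = sampled_graph_prob (step_graphon G I) n F"
      unfolding prob_step sampled_graph_prob_step[OF c k W]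
    proof (intro sum.cong prod.cong arg_cong2[where f="(*)"] refl)
      fix s i assume "s \<in> {..<n} \<rightarrow>\<^sub>E {..k}" "i \<in> {..<n}"
      then have "s i \<le> k" by auto
      then show "measure lebesgue {x \<in> {0..1}. c x = s i} = measure lebesgue {x \<in> {0..1}. d x = s i}"
        using d(3)[of "s i"] by (simp add: p_def)
    qed
  qed
  ultimately show ?thesis by blast
qed simp

end
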